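(* For each fixed $\Theta\in\left(-\frac{\pi}{2},\frac{\pi}{2}\right)$ there exists a family of smooth solutions $u^{\varepsilon}$ (indexed by all sufficiently small $\varepsilon>0$) on $B_{1}\subset\mathbb{R}^{3}$ of the special Lagrangian equation $$\sum_{i=1}^{3}\arctan\lambda_{i}=\Theta ,$$ where $\lambda_1,\lambda_2,\lambda_3$ are the eigenvalues of $D^{2}u^\varepsilon$, such that $$\left\Vert Du^{\varepsilon}\right\Vert_{L^{\infty}(B_{1})}\leq C\quad\text{but}\quad \left\vert D^{2}u^{\varepsilon}(0)\right\vert\rightarrow\infty\ \text{ as }\varepsilon\rightarrow0,$$ where the constant $C$ is independent of $\varepsilon$.
   Context: $B_{1}$ is the open unit ball of $\mathbb{R}^{3}$ centered at the origin; $\arctan$ takes values in $(-\pi/2,\pi/2)$. $|D^2u^\varepsilon(0)|$ is a matrix norm of the Hessian at the origin (e.g. the maximum of the absolute values of its eigenvalues). *)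

theory Defs
  imports
    "HOL-Analysis.Analysis"
    "HOL-Probability.Essential_Supremum"
    "HOL-Computational_Algebra.Polynomial"
begin

text \<open>Only meaningful where \<open>f\<close> is differentiable; \<open>Ck_on\<close> below demands
  differentiability wherever its partial derivatives are used.\<close>

definition partial_deriv :: "'n::finite \<Rightarrow> (real^'n \<Rightarrow> real) \<Rightarrow> real^'n \<Rightarrow> real" where
  "partial_deriv i f x = frechet_derivative f (at x) (axis i 1)"

text \<open>Intended for open \<open>S\<close>, where \<open>differentiable_on\<close> (a derivative within \<open>S\<close>)
  is differentiability at every point of \<open>S\<close>.\<close>

primrec Ck_on :: "nat \<Rightarrow> (real^'n::finite) set \<Rightarrow> (real^'n \<Rightarrow> real) \<Rightarrow> bool" where
  "Ck_on 0 S f \<longleftrightarrow> continuous_on S f"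
| "Ck_on (Suc k) S f \<longleftrightarrow> f differentiable_on S \<and> (\<forall>i. Ck_on k S (partial_deriv i f))"

definition smooth_on :: "(real^'n::finite) set \<Rightarrow> (real^'n \<Rightarrow> real) \<Rightarrow> bool" where
  "smooth_on S f \<longleftrightarrow> (\<forall>k. Ck_on k S f)"

definition gradient :: "(real^'n::finite \<Rightarrow> real) \<Rightarrow> real^'n \<Rightarrow> real^'n" where
  "gradient f x = (\<chi> i. partial_deriv i f x)"

definition hessian :: "(real^'n::finite \<Rightarrow> real) \<Rightarrow> real^'n \<Rightarrow> real^'n^'n" where
  "hessian f x = (\<chi> i j. partial_deriv i (partial_deriv j f) x)"

definition charpoly :: "real^'n^'n::finite \<Rightarrow> real poly" where
  "charpoly A = det (\<chi> i j. (if i = j then [:0, 1:] else 0) - [:A $ i $ j:])"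

text \<open>Real eigenvalues with algebraic multiplicity. For a symmetric matrix, such as the
  Hessian of a smooth function, this multiset has exactly \<open>CARD('n)\<close> elements.\<close>

definition eigenvalues :: "real^'n^'n::finite \<Rightarrow> real multiset" where
  "eigenvalues A = proots (charpoly A)"

definition special_lagrangian :: "real \<Rightarrow> (real^3) set \<Rightarrow> (real^3 \<Rightarrow> real) \<Rightarrow> bool" where
  "special_lagrangian \<Theta> S u \<longleftrightarrow>
     (\<forall>x\<in>S. (\<Sum>\<mu>\<in>#eigenvalues (hessian u x). arctan \<mu>) = \<Theta>)"

text \<open>The essential supremum is extended-real valued and is \<open>\<infinity>\<close> when \<open>f\<close> is not measurable.\<close>

definition Linfty_norm :: "'a::euclidean_space set \<Rightarrow> ('a \<Rightarrow> 'b::real_normed_vector) \<Rightarrow> ereal" where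
  "Linfty_norm S f = esssup (lebesgue_on S) (\<lambda>x. ereal (norm (f x)))"

end

theory Submission
  imports Defs "HOL-Computational_Algebra.Fundamental_Theorem_Algebra"
begin

text \<open>The gradient graph of a solution is a special Lagrangian 3-fold in \<open>\<complex>\<^sup>3\<close>, and multiplying the complex
  coordinates by unit scalars only shifts its phase. We start from a phase-\<open>0\<close> potential
  \<open>v(s,x,y) = x y tan s + h(s,y)\<close>. As it is affine in \<open>x\<close>, the equation says that
  \<open>z = y tan s\<close> is a minimal graph (the helicoid) and that \<open>h\<close> is harmonic on it. With the isothermal
  coordinate \<open>w = \<tau> + i s\<close>, \<open>y = sinh \<tau> cos s\<close>, we take
  \<open>h = \<epsilon>/2 Re sinh\<^sup>2 w - \<delta> Re sinh\<^sup>4 w\<close> for a small constant \<open>\<delta>\<close>.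

  Let \<open>\<Theta> \<le> 0\<close> (otherwise negate the solution for \<open>-\<Theta>\<close>) and \<open>\<alpha> = (\<Theta> - \<pi>/2)/2\<close>. Rotate the graph of \<open>Dv\<close> by
  \<open>\<pi>/2\<close> in the first coordinate and by \<open>\<alpha>\<close> in the other two. The projection of the rotated graph to the
  new base has Jacobian determinant
  \<open>cos\<^sup>2 \<alpha> (\<epsilon> + 12 \<delta> (s\<^sup>2 - y\<^sup>2) + \<bar>tan \<alpha>\<bar> (x\<^sup>2 + y\<^sup>2))\<close> to leading order, which is positive since
  \<open>\<bar>tan \<alpha>\<bar> \<ge> 1\<close>. The projection is injective on a fixed neighbourhood even for \<open>\<epsilon> = 0\<close>, so its image contains a
  ball independent of \<open>\<epsilon>\<close>, while the Hessian of the resulting solution has an entry \<open>\<plusminus>1/\<epsilon>\<close> at the origin.\<close>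

section \<open>Smooth functions\<close>

lemma partial_deriv_eq:
  assumes "(f has_derivative D) (at x)"
  shows "partial_deriv i f x = D (axis i 1)"
  using frechet_derivative_at[OF assms] by (simp add: partial_deriv_def)

lemma has_derivative_partial_deriv:
  fixes f :: "real^'n \<Rightarrow> real"
  assumes "f differentiable (at x)"
  shows "(f has_derivative (\<lambda>h. \<Sum>i\<in>UNIV. partial_deriv i f x * h $ i)) (at x)"
proof -
  have D: "(f has_derivative frechet_derivative f (at x)) (at x)"
    using assms frechet_derivative_works by blast
  then have lin: "linear (frechet_derivative f (at x))"
    using has_derivative_linear by blast
  have "frechet_derivative f (at x) h = (\<Sum>i\<in>UNIV. partial_deriv i f x * h $ i)" for h
  proof -
    have "frechet_derivative f (at x) h = frechet_derivative f (at x) (\<Sum>i\<in>UNIV. h $ i *\<^sub>R axis i 1)"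
      by (subst basis_expansion[of h, symmetric]) (simp add: scalar_mult_eq_scaleR)
    also have "\<dots> = (\<Sum>i\<in>UNIV. h $ i *\<^sub>R frechet_derivative f (at x) (axis i 1))"
      by (simp add: linear_sum[OF lin] linear_scale[OF lin])
    finally show ?thesis by (simp add: partial_deriv_def mult.commute)
  qed
  then show ?thesis using D by (metis (no_types, lifting) ext)
qed

lemma partial_deriv_cong:
  assumes "open S" "x \<in> S" "\<And>y. y \<in> S \<Longrightarrow> f y = g y"
  shows "partial_deriv i f x = partial_deriv i g x"
proof -
  have "(f has_derivative D) (at x) \<longleftrightarrow> (g has_derivative D) (at x)" for D
    using has_derivative_transform_within_open[OF _ assms(1,2), of f D UNIV g]
      has_derivative_transform_within_open[OF _ assms(1,2), of g D UNIV f] assms(3) by auto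
  then show ?thesis by (simp add: partial_deriv_def frechet_derivative_def)
qed

lemma Ck_on_cong:
  assumes "open S" "\<And>y. y \<in> S \<Longrightarrow> f y = g y" "Ck_on k S f"
  shows "Ck_on k S g"
  using assms(2,3)
proof (induction k arbitrary: f g)
  case 0
  then have "continuous_on S g"
    using continuous_on_cong[OF refl, of S f g] by auto
  then show ?case by simp
next
  case (Suc k)
  have "g differentiable_on S"
    unfolding differentiable_on_def
  proof
    fix x assume x: "x \<in> S"
    then have "f differentiable (at x within S)"
      using Suc.prems(2) by (simp add: differentiable_on_def)
    then show "g differentiable (at x within S)"
      by (rule differentiable_transform_within[OF _ zero_less_one x]) (simp add: Suc.prems(1))
  qed
  moreover have "Ck_on k S (partial_deriv i g)" for i
  proof (rule Suc.IH)
    show "Ck_on k S (partial_deriv i f)" using Suc.prems(2) by simp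
    show "partial_deriv i f y = partial_deriv i g y" if "y \<in> S" for y
      by (rule partial_deriv_cong[OF assms(1) that]) (rule Suc.prems(1))
  qed
  ultimately show ?case by simp
qed

lemma Ck_on_lower: "Ck_on (Suc k) S f \<Longrightarrow> Ck_on k S f"
proof (induction k arbitrary: f)
  case 0
  then show ?case by (simp add: differentiable_imp_continuous_on)
next
  case (Suc k)
  from Suc.prems have "f differentiable_on S" "\<And>i. Ck_on (Suc k) S (partial_deriv i f)"
    unfolding Ck_on.simps(2)[of "Suc k"] by blast+
  then show ?case using Suc.IH Ck_on.simps(2)[of k S f] by blast
qed

lemma Ck_on_subset: "Ck_on k S f \<Longrightarrow> T \<subseteq> S \<Longrightarrow> Ck_on k T f"
  by (induction k arbitrary: f) (auto intro: continuous_on_subset differentiable_on_subset)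

text \<open>\<open>Ck_on\<close> refers to \<open>partial_deriv\<close>, hence to a chosen
  derivative. Derivatives at a point are unique, so any explicit family \<open>D\<close> may stand
  in for it; the closure rules for \<open>Ck_on\<close> below run their induction through this
  rule.\<close>

lemma Ck_on_SucI:
  assumes "open S"
    and "\<And>x. x \<in> S \<Longrightarrow> (f has_derivative D x) (at x)"
    and "\<And>i. Ck_on k S (\<lambda>x. D x (axis i 1))"
  shows "Ck_on (Suc k) S f"
proof -
  have "f differentiable_on S"
    using assms(2) by (auto simp: differentiable_on_def differentiable_def intro: has_derivative_at_withinI)
  moreover have "Ck_on k S (partial_deriv i f)" for i
    by (rule Ck_on_cong[OF assms(1) _ assms(3)[of i]]) (simp add: partial_deriv_eq[OF assms(2)])
  ultimately show ?thesis by simp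
qed

lemma Ck_on_SucD:
  assumes "Ck_on (Suc k) S f" "open S" "x \<in> S"
  shows "(f has_derivative (\<lambda>h. \<Sum>i\<in>UNIV. partial_deriv i f x * h $ i)) (at x)"
  using assms by (intro has_derivative_partial_deriv) (auto simp: differentiable_on_eq_differentiable_at)

lemma sum_axis: "(\<Sum>i\<in>UNIV. c i * axis k (1::real) $ i) = c k"
  by (simp add: axis_def if_distrib cong: if_cong)

lemma Ck_on_const:
  assumes "open S"
  shows "Ck_on k S (\<lambda>x. c)"
proof (induction k arbitrary: c)
  case 0
  then show ?case by simp
next
  case (Suc k)
  show ?case
    by (rule Ck_on_SucI[OF assms, where D="\<lambda>x h. 0"]) (rule has_derivative_const, rule Suc)
qed

lemma Ck_on_nth: "open S \<Longrightarrow> Ck_on k S (\<lambda>x. x $ i)"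
proof (cases k)
  case (Suc m)
  assume S: "open S"
  show ?thesis unfolding Suc
    by (rule Ck_on_SucI[OF S, where D="\<lambda>x h. h $ i"])
       (auto intro: bounded_linear_imp_has_derivative bounded_linear_vec_nth Ck_on_const[OF S])
qed (simp add: continuous_on_component)

lemma Ck_on_add:
  assumes "open S"
  shows "Ck_on k S f \<Longrightarrow> Ck_on k S g \<Longrightarrow> Ck_on k S (\<lambda>x. f x + g x)"
proof (induction k arbitrary: f g)
  case 0
  then show ?case by (simp add: continuous_on_add)
next
  case (Suc k)
  show ?case
  proof (rule Ck_on_SucI[OF assms])
    fix x assume "x \<in> S"
    note D = Ck_on_SucD[OF Suc.prems(1) assms this] Ck_on_SucD[OF Suc.prems(2) assms this]
    show "((\<lambda>x. f x + g x) has_derivative (\<lambda>h. (\<Sum>i\<in>UNIV. partial_deriv i f x * h $ i) +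
        (\<Sum>i\<in>UNIV. partial_deriv i g x * h $ i))) (at x)"
      by (rule has_derivative_add[OF D])
  next
    show "Ck_on k S (\<lambda>x. (\<Sum>j\<in>UNIV. partial_deriv j f x * axis i 1 $ j) +
        (\<Sum>j\<in>UNIV. partial_deriv j g x * axis i 1 $ j))" for i
      unfolding sum_axis using Suc by auto
  qed
qed

text \<open>By the product rule each partial derivative is a sum of products of a partial derivative
  with an undifferentiated factor, whose order \<open>Ck_on_lower\<close> reduces; hence
  \<open>f\<close> and \<open>g\<close> vary in the induction.\<close>

lemma Ck_on_mult:
  assumes "open S"
  shows "Ck_on k S f \<Longrightarrow> Ck_on k S g \<Longrightarrow> Ck_on k S (\<lambda>x. f x * g x)"
proof (induction k arbitrary: f g)
  case 0
  then show ?case by (simp add: continuous_on_mult)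
next
  case (Suc k)
  show ?case
  proof (rule Ck_on_SucI[OF assms])
    fix x assume "x \<in> S"
    note D = Ck_on_SucD[OF Suc.prems(1) assms this] Ck_on_SucD[OF Suc.prems(2) assms this]
    show "((\<lambda>x. f x * g x) has_derivative (\<lambda>h. f x * (\<Sum>i\<in>UNIV. partial_deriv i g x * h $ i) +
        (\<Sum>i\<in>UNIV. partial_deriv i f x * h $ i) * g x)) (at x)"
      by (rule has_derivative_mult[OF D])
  next
    show "Ck_on k S (\<lambda>x. f x * (\<Sum>j\<in>UNIV. partial_deriv j g x * axis i 1 $ j) +
        (\<Sum>j\<in>UNIV. partial_deriv j f x * axis i 1 $ j) * g x)" for i
      unfolding sum_axis using Suc.prems Suc.prems[THEN Ck_on_lower]
      by (intro Ck_on_add[OF assms] Suc.IH) simp_all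
  qed
qed

text \<open>The partial derivatives of \<open>1 / f\<close> are polynomials in \<open>1 / f\<close>
  and the partial derivatives of \<open>f\<close>, so the induction hypothesis for the same
  \<open>f\<close> suffices.\<close>

lemma Ck_on_inverse:
  assumes "open S" "\<And>x. x \<in> S \<Longrightarrow> f x \<noteq> 0"
  shows "Ck_on k S f \<Longrightarrow> Ck_on k S (\<lambda>x. inverse (f x))"
proof (induction k)
  case 0
  then show ?case using assms(2) by (simp add: continuous_on_inverse)
next
  case (Suc k)
  show ?case
  proof (rule Ck_on_SucI[OF assms(1)])
    fix x assume x: "x \<in> S"
    show "((\<lambda>x. inverse (f x)) has_derivative (\<lambda>h. (-1) *
        (inverse (f x) * (\<Sum>i\<in>UNIV. partial_deriv i f x * h $ i) * inverse (f x)))) (at x)"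
      using Deriv.has_derivative_inverse[OF assms(2)[OF x] Ck_on_SucD[OF Suc.prems assms(1) x]] by simp
  next
    show "Ck_on k S (\<lambda>x. (-1) *
        (inverse (f x) * (\<Sum>j\<in>UNIV. partial_deriv j f x * axis i 1 $ j) * inverse (f x)))" for i
      unfolding sum_axis using Suc.prems Suc.prems[THEN Ck_on_lower]
      by (intro Ck_on_mult[OF assms(1)] Ck_on_const[OF assms(1)] Suc.IH) simp_all
  qed
qed

text \<open>The equation \<open>tan' = 1 + tan^2\<close> expresses the partial derivatives through
  \<open>tan (f x)\<close> itself and closes the induction.\<close>

lemma Ck_on_tan:
  assumes "open S" "\<And>x. x \<in> S \<Longrightarrow> cos (f x) \<noteq> 0"
  shows "Ck_on k S f \<Longrightarrow> Ck_on k S (\<lambda>x. tan (f x))"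
proof (induction k)
  case 0
  then show ?case
    unfolding Ck_on.simps(1) tan_def using assms(2) by (intro continuous_intros) auto
next
  case (Suc k)
  show ?case
  proof (rule Ck_on_SucI[OF assms(1)])
    fix x assume x: "x \<in> S"
    have "(tan has_real_derivative (1 + tan (f x) * tan (f x))) (at (f x))"
      using DERIV_tan[OF assms(2)[OF x]] tan_sec[OF assms(2)[OF x]]
      by (simp add: power2_eq_square)
    from DERIV_compose_FDERIV[OF this Ck_on_SucD[OF Suc.prems assms(1) x]]
    show "((\<lambda>x. tan (f x)) has_derivative (\<lambda>h.
        (\<Sum>i\<in>UNIV. partial_deriv i f x * h $ i) * (1 + tan (f x) * tan (f x)))) (at x)" .
  next
    show "Ck_on k S (\<lambda>x. (\<Sum>j\<in>UNIV. partial_deriv j f x * axis i 1 $ j) *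
        (1 + tan (f x) * tan (f x)))" for i
      unfolding sum_axis using Suc.prems Suc.prems[THEN Ck_on_lower]
      by (intro Ck_on_mult[OF assms(1)] Ck_on_const[OF assms(1)] Ck_on_add[OF assms(1)] Suc.IH)
         simp_all
  qed
qed

lemma smooth_on_const: "open S \<Longrightarrow> smooth_on S (\<lambda>x. c)"
  by (simp add: smooth_on_def Ck_on_const)

lemma smooth_on_nth: "open S \<Longrightarrow> smooth_on S (\<lambda>x. x $ i)"
  by (simp add: smooth_on_def Ck_on_nth)

lemma smooth_on_add:
  "open S \<Longrightarrow> smooth_on S f \<Longrightarrow> smooth_on S g \<Longrightarrow> smooth_on S (\<lambda>x. f x + g x)"
  by (simp add: smooth_on_def Ck_on_add)

lemma smooth_on_mult:
  "open S \<Longrightarrow> smooth_on S f \<Longrightarrow> smooth_on S g \<Longrightarrow> smooth_on S (\<lambda>x. f x * g x)"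
  by (simp add: smooth_on_def Ck_on_mult)

lemma smooth_on_minus: "open S \<Longrightarrow> smooth_on S f \<Longrightarrow> smooth_on S (\<lambda>x. - f x)"
  using smooth_on_mult[OF _ smooth_on_const, of S f "-1"] by simp

lemma smooth_on_diff:
  "open S \<Longrightarrow> smooth_on S f \<Longrightarrow> smooth_on S g \<Longrightarrow> smooth_on S (\<lambda>x. f x - g x)"
  using smooth_on_add[OF _ _ smooth_on_minus, of S f g] by simp

lemma smooth_on_power: "open S \<Longrightarrow> smooth_on S f \<Longrightarrow> smooth_on S (\<lambda>x. f x ^ n)"
  by (induction n) (auto intro: smooth_on_const smooth_on_mult)

lemma smooth_on_inverse:
  "open S \<Longrightarrow> smooth_on S f \<Longrightarrow> (\<And>x. x \<in> S \<Longrightarrow> f x \<noteq> 0) \<Longrightarrow> smooth_on S (\<lambda>x. inverse (f x))"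
  by (simp add: smooth_on_def Ck_on_inverse)

lemma smooth_on_divide:
  "open S \<Longrightarrow> smooth_on S f \<Longrightarrow> smooth_on S g \<Longrightarrow> (\<And>x. x \<in> S \<Longrightarrow> g x \<noteq> 0) \<Longrightarrow>
    smooth_on S (\<lambda>x. f x / g x)"
  unfolding divide_inverse by (intro smooth_on_mult smooth_on_inverse)

lemma smooth_on_tan:
  "open S \<Longrightarrow> smooth_on S f \<Longrightarrow> (\<And>x. x \<in> S \<Longrightarrow> cos (f x) \<noteq> 0) \<Longrightarrow> smooth_on S (\<lambda>x. tan (f x))"
  by (simp add: smooth_on_def Ck_on_tan)

lemma smooth_on_sum:
  "open S \<Longrightarrow> (\<And>i. i \<in> I \<Longrightarrow> smooth_on S (f i)) \<Longrightarrow> smooth_on S (\<lambda>x. \<Sum>i\<in>I. f i x)"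
  by (induction I rule: infinite_finite_induct) (auto intro: smooth_on_const smooth_on_add)

lemma smooth_on_prod:
  "open S \<Longrightarrow> (\<And>i. i \<in> I \<Longrightarrow> smooth_on S (f i)) \<Longrightarrow> smooth_on S (\<lambda>x. \<Prod>i\<in>I. f i x)"
  by (induction I rule: infinite_finite_induct) (auto intro: smooth_on_const smooth_on_mult)

lemma smooth_on_det:
  assumes "open S" "\<And>i j. smooth_on S (\<lambda>x. A x $ i $ j)"
  shows "smooth_on S (\<lambda>x. det (A x))"
  unfolding det_def
  by (intro smooth_on_sum smooth_on_mult smooth_on_const smooth_on_prod assms)

lemma smooth_on_subset: "smooth_on S f \<Longrightarrow> T \<subseteq> S \<Longrightarrow> smooth_on T f"
  unfolding smooth_on_def using Ck_on_subset by blast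

lemma smooth_on_partial_deriv: "smooth_on S f \<Longrightarrow> smooth_on S (partial_deriv i f)"
  unfolding smooth_on_def using Ck_on.simps(2) by blast

lemma smooth_on_has_derivative:
  "smooth_on S f \<Longrightarrow> open S \<Longrightarrow> x \<in> S \<Longrightarrow>
    (f has_derivative (\<lambda>h. \<Sum>i\<in>UNIV. partial_deriv i f x * h $ i)) (at x)"
  using Ck_on_SucD smooth_on_def by blast

lemma smooth_on_imp_continuous_on: "smooth_on S f \<Longrightarrow> continuous_on S f"
  unfolding smooth_on_def using Ck_on.simps(1) by blast

section \<open>Inverse charts\<close>

definition jacobi_matrix :: "(real^'n::finite \<Rightarrow> real^'n) \<Rightarrow> real^'n \<Rightarrow> real^'n^'n" where
  "jacobi_matrix F x = (\<chi> i j. partial_deriv j (\<lambda>y. F y $ i) x)"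

lemma jacobi_matrix_nth: "jacobi_matrix F x $ i $ j = partial_deriv j (\<lambda>y. F y $ i) x"
  by (simp add: jacobi_matrix_def)

text \<open>These assumptions make \<open>F\<close> a diffeomorphism onto an open set. In the
  application \<open>F\<close> is the rescaled projection of the rotated graph to its new base, and
  functions on the graph are carried to the base by \<open>inv_chart\<close>.\<close>

locale chart =
  fixes U :: "(real^'n::finite) set" and F :: "real^'n \<Rightarrow> real^'n"
  assumes open_dom: "open U"
    and inj: "inj_on F U"
    and smooth: "\<And>i. smooth_on U (\<lambda>x. F x $ i)"
    and det_nz: "\<And>x. x \<in> U \<Longrightarrow> det (jacobi_matrix F x) \<noteq> 0"
begin

definition inv_chart :: "real^'n \<Rightarrow> real^'n" where "inv_chart = the_inv_into U F"

lemma inv_chart_F: "x \<in> U \<Longrightarrow> inv_chart (F x) = x"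
  unfolding inv_chart_def by (rule the_inv_into_f_f[OF inj])

lemma has_derivative_F:
  assumes "x \<in> U"
  shows "(F has_derivative (\<lambda>h. jacobi_matrix F x *v h)) (at x)"
proof -
  have eq: "(jacobi_matrix F x *v h) $ i = (\<Sum>j\<in>UNIV. partial_deriv j (\<lambda>y. F y $ i) x * h $ j)" for h i
    by (simp add: jacobi_matrix_def matrix_vector_mult_def)
  have "((\<lambda>y. F y $ i) has_derivative (\<lambda>h. (jacobi_matrix F x *v h) $ i)) (at x)" for i
    unfolding eq by (rule smooth_on_has_derivative[OF smooth open_dom assms])
  then show ?thesis
    by (subst has_derivative_componentwise_within) (auto simp: Basis_vec_def inner_axis)
qed

lemma continuous_on_F: "continuous_on U F"
  by (meson has_derivative_F continuous_at_imp_continuous_on has_derivative_continuous)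

lemma open_image: "open (F ` U)"
  using invariance_of_domain[OF continuous_on_F open_dom inj] .

text \<open>Invariance of domain makes the image open and the inverse continuous; together with the
  invertible derivative of \<open>F\<close> this gives differentiability of the inverse.\<close>

lemma has_derivative_inv_chart:
  assumes "x \<in> U"
  shows "(inv_chart has_derivative (\<lambda>h. matrix_inv (jacobi_matrix F x) *v h)) (at (F x))"
proof (rule has_derivative_inverse_basic[where T="F ` U"])
  show "(F has_derivative (\<lambda>h. jacobi_matrix F x *v h)) (at (inv_chart (F x)))"
    using has_derivative_F[OF assms] inv_chart_F[OF assms] by simp
  have "\<exists>B. jacobi_matrix F x ** B = mat 1 \<and> B ** jacobi_matrix F x = mat 1"
    using det_nz[OF assms] invertible_det_nz unfolding invertible_def by blast
  then have "matrix_inv (jacobi_matrix F x) ** jacobi_matrix F x = mat 1"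
    unfolding matrix_inv_def by (rule someI2_ex) blast
  then show "(\<lambda>h. matrix_inv (jacobi_matrix F x) *v h) \<circ> (\<lambda>h. jacobi_matrix F x *v h) = id"
    by (auto simp: matrix_vector_mul_assoc)
  obtain g where g: "homeomorphism U (F ` U) F g"
    using invariance_of_domain_homeomorphism[OF open_dom continuous_on_F _ inj] by auto
  have "inv_chart y = g y" if "y \<in> F ` U" for y
    using that g inv_chart_F by (auto simp: homeomorphism_def)
  then have "continuous_on (F ` U) inv_chart"
    using homeomorphism_cont2[OF g] continuous_on_cong[OF refl, of "F ` U" inv_chart g] by blast
  then show "continuous (at (F x)) inv_chart"
    using open_image assms by (simp add: continuous_on_eq_continuous_at)
qed (use assms open_image inv_chart_F in auto)

lemma has_derivative_pullback:
  assumes "smooth_on U f" "x \<in> U"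
  shows "(f \<circ> inv_chart has_derivative (\<lambda>h. \<Sum>i\<in>UNIV. partial_deriv i f x * (matrix_inv (jacobi_matrix F x) *v h) $ i)) (at (F x))"
  using diff_chain_at[OF has_derivative_inv_chart[OF assms(2)], of f] 
    smooth_on_has_derivative[OF assms(1) open_dom assms(2)] inv_chart_F[OF assms(2)] by (simp add: o_def)

text \<open>Chain rule for \<open>f\<close> as the composition of its pullback with
  \<open>F\<close>. It is a linear system for the gradient of the pullback whose data are evaluated
  at \<open>x\<close>.\<close>

lemma gradient_pullback:
  assumes "smooth_on U f" "x \<in> U"
  shows "transpose (jacobi_matrix F x) *v gradient (f \<circ> inv_chart) (F x) = gradient f x"
proof -
  have d: "(f \<circ> inv_chart) differentiable at (F x)"
    using has_derivative_pullback[OF assms] differentiable_def by blast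
  have "((f \<circ> inv_chart) \<circ> F has_derivative
      (\<lambda>h. \<Sum>i\<in>UNIV. partial_deriv i (f \<circ> inv_chart) (F x) * (jacobi_matrix F x *v h) $ i)) (at x)"
    using diff_chain_at[OF has_derivative_F[OF assms(2)] has_derivative_partial_deriv[OF d]]
    by (simp add: o_def)
  then have D: "(f has_derivative
      (\<lambda>h. \<Sum>i\<in>UNIV. partial_deriv i (f \<circ> inv_chart) (F x) * (jacobi_matrix F x *v h) $ i)) (at x)"
    by (rule has_derivative_transform_within_open[OF _ open_dom assms(2)]) (simp add: inv_chart_F)
  have "(jacobi_matrix F x *v axis k 1) $ i = jacobi_matrix F x $ i $ k" for i k
    by (simp add: matrix_vector_mult_def axis_def if_distrib cong: if_cong)
  then show ?thesis
    by (simp add: vec_eq_iff gradient_def partial_deriv_eq[OF D] matrix_vector_mult_def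
        transpose_def mult.commute)
qed

text \<open>Cramer's rule for the system in \<open>gradient_pullback\<close>. The quotient of
  determinants is a smooth function of \<open>x\<close>, so a partial derivative of a pullback is
  again a pullback.\<close>

lemma partial_deriv_pullback:
  assumes "smooth_on U f" "x \<in> U"
  shows "partial_deriv k (f \<circ> inv_chart) (F x) =
    det (\<chi> i j. if j = k then partial_deriv i f x else jacobi_matrix F x $ j $ i) / det (jacobi_matrix F x)"
proof -
  have "gradient (f \<circ> inv_chart) (F x) = (\<chi> k. det (\<chi> i j. if j = k then gradient f x $ i
      else transpose (jacobi_matrix F x) $ i $ j) / det (transpose (jacobi_matrix F x)))"
    using gradient_pullback[OF assms] det_nz[OF assms(2)] by (subst cramer[symmetric]) auto
  then have "gradient (f \<circ> inv_chart) (F x) $ k = det (\<chi> i j. if j = k then gradient f x $ i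
      else transpose (jacobi_matrix F x) $ i $ j) / det (transpose (jacobi_matrix F x))"
    by (metis (no_types, lifting) vec_lambda_beta)
  then show ?thesis by (simp add: gradient_def transpose_def cong: if_cong) (metis det_transpose transpose_def)
qed

text \<open>Induction on the order over all smooth \<open>f\<close> at once: the partial derivatives
  are pullbacks of the smooth quotients \<open>g i\<close> from Cramer's rule.\<close>

lemma smooth_on_pullback:
  assumes "smooth_on U f"
  shows "smooth_on (F ` U) (f \<circ> inv_chart)"
proof -
  have "Ck_on k (F ` U) (f \<circ> inv_chart)" for k
    using assms
  proof (induction k arbitrary: f)
    case 0
    then show ?case
      unfolding Ck_on.simps
      by (intro continuous_at_imp_continuous_on)
         (use has_derivative_continuous[OF has_derivative_pullback[OF 0]] in blast)
  next
    case (Suc k)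
    define g where "g i x = det (\<chi> l j. if j = i then partial_deriv l f x else jacobi_matrix F x $ j $ l)
      / det (jacobi_matrix F x)" for i x
    have sm: "smooth_on U (\<lambda>x. jacobi_matrix F x $ l $ j)" for l j
      by (simp add: jacobi_matrix_def smooth_on_partial_deriv smooth)
    have "smooth_on U (g i)" for i
      unfolding g_def
    proof (intro smooth_on_divide smooth_on_det open_dom det_nz)
      show "smooth_on U (\<lambda>x. (\<chi> l j. if j = i then partial_deriv l f x else jacobi_matrix F x $ j $ l) $ l $ j)"
        for l j
        using smooth_on_partial_deriv[OF Suc.prems] sm by (cases "j = i") auto
    qed (rule sm)
    then have pb: "Ck_on k (F ` U) (g i \<circ> inv_chart)" for i
      by (rule Suc.IH)
    have "(g i \<circ> inv_chart) y = partial_deriv i (f \<circ> inv_chart) y" if "y \<in> F ` U" for i y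
    proof -
      from that obtain x where "x \<in> U" "y = F x" by blast
      then show ?thesis
        unfolding g_def by (simp only: o_apply inv_chart_F partial_deriv_pullback[OF Suc.prems])
    qed
    then have "Ck_on k (F ` U) (partial_deriv i (f \<circ> inv_chart))" for i
      by (rule Ck_on_cong[OF open_image _ pb])
    moreover have "(f \<circ> inv_chart) differentiable_on (F ` U)"
      using has_derivative_pullback[OF Suc.prems]
      by (auto simp: differentiable_on_eq_differentiable_at[OF open_image] differentiable_def)
    ultimately show ?case unfolding Ck_on.simps(2) by blast
  qed
  then show ?thesis by (simp add: smooth_on_def)
qed

end

section \<open>Eigenvalues and phase\<close>

text \<open>Split a complex eigenvector into real and imaginary parts \<open>p\<close> and
  \<open>q\<close>. Symmetry in the form \<open>q \<bullet> (A *v p) = p \<bullet> (A *v q)\<close>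
  leaves \<open>Im z\<close> times a positive number equal to zero.\<close>

lemma symmetric_eigenvalue_real:
  fixes A :: "real^'n^'n"
  assumes sym: "transpose A = A"
    and det: "det (\<chi> i j. (if i = j then z else 0) - complex_of_real (A $ i $ j)) = 0"
  shows "Im z = 0"
proof -
  let ?B = "(\<chi> i j. (if i = j then z else 0) - complex_of_real (A $ i $ j)) :: complex^'n^'n"
  have "\<not> invertible ?B" using det invertible_det_nz by blast
  then have "\<not> (\<exists>C. C ** ?B = mat 1)"
    unfolding invertible_def using matrix_left_right_inverse[of _ ?B] by blast
  then obtain v where v: "?B *v v = 0" "v \<noteq> 0"
    unfolding matrix_left_invertible_ker by blast
  define p q where "p = (\<chi> i. Re (v $ i))" and "q = (\<chi> i. Im (v $ i))"
  have "(\<Sum>j\<in>UNIV. complex_of_real (A $ i $ j) * v $ j) = z * v $ i" for i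
  proof -
    have "(if i = j then z else 0) * v $ j = (if i = j then z * v $ i else 0)" for j
      by simp
    then have "(\<Sum>j\<in>UNIV. (if i = j then z else 0) * v $ j) = z * v $ i"
      by simp
    moreover have "(?B *v v) $ i = 0" using v(1) by simp
    then have "(\<Sum>j\<in>UNIV. (if i = j then z else 0) * v $ j) -
        (\<Sum>j\<in>UNIV. complex_of_real (A $ i $ j) * v $ j) = 0"
      unfolding matrix_vector_mult_def sum_subtractf[symmetric] left_diff_distrib[symmetric] by simp
    ultimately show ?thesis by simp
  qed
  note eq = this
  have Ap: "A *v p = Re z *\<^sub>R p - Im z *\<^sub>R q"
    using arg_cong[OF eq, of Re] by (simp add: vec_eq_iff matrix_vector_mult_def p_def q_def)
  have Aq: "A *v q = Im z *\<^sub>R p + Re z *\<^sub>R q"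
    using arg_cong[OF eq, of Im]
    by (simp add: vec_eq_iff matrix_vector_mult_def p_def q_def algebra_simps)
  have "q \<bullet> (A *v p) = p \<bullet> (A *v q)"
    by (metis dot_lmul_matrix inner_commute sym transpose_matrix_vector)
  then have "Im z * (p \<bullet> p + q \<bullet> q) = 0"
    unfolding Ap Aq by (simp add: inner_simps inner_commute[of q p] algebra_simps)
  moreover have "p \<bullet> p + q \<bullet> q > 0"
  proof -
    have "p \<noteq> 0 \<or> q \<noteq> 0"
      using v(2) by (auto simp: vec_eq_iff p_def q_def complex_eq_iff)
    then show ?thesis
      by (meson add_pos_nonneg add_nonneg_pos inner_ge_zero inner_gt_zero_iff)
  qed
  ultimately show ?thesis by simp
qed

lemma charpoly_3:
  fixes A :: "real^3^3"
  defines "s1 \<equiv> A$1$1 + A$2$2 + A$3$3"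
    and "s2 \<equiv> A$1$1*A$2$2 - A$1$2*A$2$1 + A$1$1*A$3$3 - A$1$3*A$3$1 + A$2$2*A$3$3 - A$2$3*A$3$2"
  shows "charpoly A = [:- det A, s2, - s1, 1:]"
    and "det (\<chi> i j. (if i = j then z else 0) - complex_of_real (A $ i $ j)) =
      z ^ 3 - of_real s1 * z ^ 2 + of_real s2 * z - of_real (det A)"
proof -
  show "charpoly A = [:- det A, s2, - s1, 1:]"
    unfolding charpoly_def s1_def s2_def det_3 by (simp add: algebra_simps)
  show "det (\<chi> i j. (if i = j then z else 0) - complex_of_real (A $ i $ j)) =
      z ^ 3 - of_real s1 * z ^ 2 + of_real s2 * z - of_real (det A)"
    unfolding s1_def s2_def det_3
    by (simp add: algebra_simps power2_eq_square power3_eq_cube)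
qed

text \<open>A complex root of the cubic exists and is real by symmetry. After dividing it out, a
  root of the remaining quadratic is again a root of the cubic, hence real; the trace determines the
  third root.\<close>

lemma charpoly_symmetric_splits:
  fixes A :: "real^3^3"
  assumes sym: "transpose A = A"
  obtains a b c where "charpoly A = [:- a, 1:] * [:- b, 1:] * [:- c, 1:]"
proof -
  define s1 s2 where "s1 = A$1$1 + A$2$2 + A$3$3"
    and "s2 = A$1$1*A$2$2 - A$1$2*A$2$1 + A$1$1*A$3$3 - A$1$3*A$3$1 + A$2$2*A$3$3 - A$2$3*A$3$2"
  define f where "f z = z ^ 3 - complex_of_real s1 * z ^ 2 + of_real s2 * z - of_real (det A)" for z
  have real: "z = of_real (Re z)" if "f z = 0" for z
  proof -
    have "Im z = 0"
      using that symmetric_eigenvalue_real[OF sym, of z]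
      by (simp add: charpoly_3(2) f_def s1_def s2_def)
    then show ?thesis by (simp add: complex_eq_iff)
  qed
  have "\<exists>z. poly [:- of_real (det A), of_real s2, - of_real s1, 1:] z = (0::complex)"
    by (rule fundamental_theorem_of_algebra_alt) simp
  then obtain z where z: "f z = 0"
    by (auto simp: f_def algebra_simps power2_eq_square power3_eq_cube)
  define a where "a = Re z"
  have "f (of_real a) = 0" using z real[OF z] a_def by simp
  then have "complex_of_real (a ^ 3 - s1 * a ^ 2 + s2 * a - det A) = 0"
    by (simp add: f_def)
  then have a: "a ^ 3 - s1 * a ^ 2 + s2 * a - det A = 0"
    by (simp only: of_real_eq_0_iff)
  \<comment> \<open>This quadratic is the quotient of the cubic by \<open>z - a\<close>.\<close>
  have "\<exists>w. poly [:of_real (s2 + a\<^sup>2 - s1 * a), of_real (a - s1), 1:] w = (0::complex)"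
    by (rule fundamental_theorem_of_algebra_alt) simp
  then obtain w :: complex
    where w: "w\<^sup>2 + of_real (a - s1) * w + of_real (s2 + a\<^sup>2 - s1 * a) = 0"
    by (auto simp: algebra_simps power2_eq_square)
  have "f w = (w - of_real a) * (w\<^sup>2 + of_real (a - s1) * w + of_real (s2 + a\<^sup>2 - s1 * a))
      + of_real (a ^ 3 - s1 * a ^ 2 + s2 * a - det A)"
    by (simp add: f_def algebra_simps power2_eq_square power3_eq_cube)
  then have "f w = 0" by (simp only: w a) simp
  define b where "b = Re w"
  have wb: "w = of_real b" using real[OF \<open>f w = 0\<close>] b_def by simp
  have "complex_of_real (b\<^sup>2 + (a - s1) * b + (s2 + a\<^sup>2 - s1 * a)) = 0"
    using w unfolding wb by simp
  then have b: "b\<^sup>2 + (a - s1) * b + (s2 + a\<^sup>2 - s1 * a) = 0"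
    by (simp only: of_real_eq_0_iff)
  have s2: "s2 = - b\<^sup>2 - (a - s1) * b - a\<^sup>2 + s1 * a" using b by simp
  have d: "det A = a ^ 3 - s1 * a ^ 2 + s2 * a" using a by simp
  have "charpoly A = [:- a, 1:] * [:- b, 1:] * [:- (s1 - a - b), 1:]"
    unfolding charpoly_3(1)[of A, folded s1_def s2_def] d s2
    by (simp add: algebra_simps power2_eq_square power3_eq_cube)
  then show ?thesis by (rule that)
qed

lemma one_plus_i_times: "1 + \<i> * complex_of_real t = of_real (sqrt (1 + t\<^sup>2)) * cis (arctan t)"
proof -
  have "sqrt (1 + t\<^sup>2) > 0" by (simp add: add_pos_nonneg)
  then show ?thesis
    by (simp add: complex_eq_iff sin_arctan cos_arctan)
qed

text \<open>The bounds \<open>\<bar>\<Theta>\<bar> < \<pi>/2\<close> and \<open>\<bar>\<Sum> arctan \<mu>\<bar> < 3\<pi>/2\<close> exclude a phase shift by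
  a nonzero multiple of \<open>2\<pi>\<close>.\<close>

lemma sum_arctan_eigenvalues:
  fixes A :: "real^3^3"
  assumes sym: "transpose A = A"
    and det: "det (\<chi> i j. (if i = j then 1 else 0) + \<i> * complex_of_real (A $ i $ j)) = of_real R * cis \<Theta>"
    and "R > 0" and \<Theta>: "\<bar>\<Theta>\<bar> < pi / 2"
  shows "(\<Sum>\<mu>\<in>#eigenvalues A. arctan \<mu>) = \<Theta>"
proof -
  obtain a b c where abc: "charpoly A = [:- a, 1:] * [:- b, 1:] * [:- c, 1:]"
    using charpoly_symmetric_splits[OF sym] by blast
  have "eigenvalues A = {#a, b, c#}"
    unfolding eigenvalues_def abc by (subst proots_mult, simp, simp)+ simp
  then have sum: "(\<Sum>\<mu>\<in>#eigenvalues A. arctan \<mu>) = arctan a + arctan b + arctan c"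
    by simp
  define s1 s2 where "s1 = A$1$1 + A$2$2 + A$3$3"
    and "s2 = A$1$1*A$2$2 - A$1$2*A$2$1 + A$1$1*A$3$3 - A$1$3*A$3$1 + A$2$2*A$3$3 - A$2$3*A$3$2"
  have coeffs: "det A = a * b * c" "s2 = a * b + a * c + b * c" "s1 = a + b + c"
    using abc charpoly_3(1)[of A, folded s1_def s2_def] by (auto simp: algebra_simps)
  have "det (\<chi> i j. (if i = j then 1 else 0) + \<i> * complex_of_real (A $ i $ j))
      = 1 + \<i> * of_real s1 - of_real s2 - \<i> * of_real (det A)"
    unfolding s1_def s2_def det_3 by (simp add: algebra_simps)
  also have "\<dots> = (1 + \<i> * of_real a) * (1 + \<i> * of_real b) * (1 + \<i> * of_real c)"
    unfolding coeffs by (simp add: algebra_simps)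
  also have "\<dots> = of_real (sqrt (1 + a\<^sup>2) * sqrt (1 + b\<^sup>2) * sqrt (1 + c\<^sup>2)) *
      cis (arctan a + arctan b + arctan c)"
    unfolding one_plus_i_times by (simp add: cis_mult[symmetric] mult_ac)
  finally have eq: "of_real (sqrt (1 + a\<^sup>2) * sqrt (1 + b\<^sup>2) * sqrt (1 + c\<^sup>2)) *
      cis (arctan a + arctan b + arctan c) = of_real R * cis \<Theta>"
    using det by simp
  define Q where "Q = sqrt (1 + a\<^sup>2) * sqrt (1 + b\<^sup>2) * sqrt (1 + c\<^sup>2)"
  have "Q > 0" by (simp add: Q_def add_pos_nonneg)
  have eq': "of_real Q * cis (arctan a + arctan b + arctan c) = of_real R * cis \<Theta>"
    using eq unfolding Q_def .
  \<comment> \<open>Both sides are in polar form with positive modulus: equal norms leave equal unit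
    factors.\<close>
  have "Q = R"
    using arg_cong[OF eq', of norm] \<open>Q > 0\<close> \<open>R > 0\<close> by (simp add: norm_mult)
  then have "cis (arctan a + arctan b + arctan c) = cis \<Theta>"
    using eq' \<open>R > 0\<close> by simp
  then have "sin (arctan a + arctan b + arctan c) = sin \<Theta> \<and> cos (arctan a + arctan b + arctan c) = cos \<Theta>"
    by (simp add: complex_eq_iff)
  then obtain n :: int where n: "arctan a + arctan b + arctan c = \<Theta> + 2 * pi * n"
    unfolding sin_cos_eq_iff by blast
  have "\<bar>2 * pi * n\<bar> < 2 * pi"
    using n arctan_bounded[of a] arctan_bounded[of b] arctan_bounded[of c] \<Theta> by linarith
  then have "\<bar>real_of_int n\<bar> < 1"
    by (simp add: abs_mult)
  then have "n = 0" by linarith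
  then show ?thesis using sum n by simp
qed

section \<open>The potential over the helicoid\<close>

lemma has_derivative_nth: "((\<lambda>x. x $ i) has_derivative (\<lambda>h. h $ i)) (at x within S)"
  by (rule bounded_linear_imp_has_derivative) (rule bounded_linear_vec_nth)

definition tan1 :: "real^3 \<Rightarrow> real" where "tan1 \<xi> = tan (\<xi> $ 1)"

text \<open>This is \<open>cos^2\<close> wherever the cosine is nonzero. Written through
  \<open>tan1\<close>, it makes \<open>pot\<close> and its derivatives polynomials in
  \<open>tan1\<close>, \<open>cossq1\<close> and the coordinates, subject to the single relation
  \<open>cossq1_tan1\<close>.\<close>

definition cossq1 :: "real^3 \<Rightarrow> real" where "cossq1 \<xi> = inverse (1 + (tan1 \<xi>)\<^sup>2)"

lemma cossq1_tan1: "cossq1 \<xi> * (1 + (tan1 \<xi>)\<^sup>2) = 1"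
proof -
  have "1 + (tan1 \<xi>)\<^sup>2 > 0" by (simp add: add_pos_nonneg)
  then show ?thesis by (simp add: cossq1_def)
qed

lemma has_derivative_tan1:
  assumes "cos (\<xi> $ 1) \<noteq> 0"
  shows "(tan1 has_derivative (\<lambda>h. (1 + (tan1 \<xi>)\<^sup>2) * h $ 1)) (at \<xi>)"
proof -
  have "(tan has_real_derivative (1 + (tan (\<xi> $ 1))\<^sup>2)) (at (\<xi> $ 1))"
    using DERIV_tan[OF assms] tan_sec[OF assms] by (simp add: power_inverse)
  from DERIV_compose_FDERIV[OF this has_derivative_nth]
  show ?thesis unfolding tan1_def by (simp add: mult.commute)
qed

lemma has_derivative_cossq1:
  assumes "cos (\<xi> $ 1) \<noteq> 0"
  shows "(cossq1 has_derivative (\<lambda>h. - 2 * tan1 \<xi> * cossq1 \<xi> * h $ 1)) (at \<xi>)"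
proof -
  have nz: "1 + (tan1 \<xi>)\<^sup>2 \<noteq> 0" using cossq1_tan1[of \<xi>] by auto
  have "((\<lambda>\<xi>. inverse (1 + (tan1 \<xi>)\<^sup>2)) has_derivative
      (\<lambda>h. - (cossq1 \<xi> * (2 * tan1 \<xi> * ((1 + (tan1 \<xi>)\<^sup>2) * h $ 1)) * cossq1 \<xi>))) (at \<xi>)"
    unfolding cossq1_def by (rule derivative_eq_intros has_derivative_tan1[OF assms] nz refl | simp add: mult_ac)+
  moreover have "- (cossq1 \<xi> * (2 * tan1 \<xi> * ((1 + (tan1 \<xi>)\<^sup>2) * t)) * cossq1 \<xi>) = - 2 * tan1 \<xi> * cossq1 \<xi> * t" for t
    using cossq1_tan1[of \<xi>] by algebra
  ultimately show ?thesis unfolding cossq1_def[abs_def, symmetric] by simp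
qed

text \<open>This is the constant \<delta>: positive, so that the projection stays injective along
  the axis even for \<open>e = 0\<close>, and small enough to be absorbed in the bounds on
  \<open>pot11\<close>, \<open>pot13\<close> and \<open>pot33\<close>.\<close>

definition quartic_weight :: real where "quartic_weight = 1 / 100000"

text \<open>The coefficient of \<open>e / 2\<close> is \<open>1 + Re sinh\<^sup>2 w\<close> and that of \<open>quartic_weight\<close> is \<open>- Re sinh\<^sup>4 w\<close>. The
  suffixes of \<open>pot1\<close>, \<open>pot12\<close> etc. name the partial derivatives; \<open>pot22 = 0\<close> and \<open>pot23 = tan1\<close>.\<close>

definition pot :: "real \<Rightarrow> real^3 \<Rightarrow> real" where
  "pot e \<xi> = \<xi>$2 * \<xi>$3 * tan1 \<xi> + e / 2 * ((\<xi>$3)\<^sup>2 * (1 - (tan1 \<xi>)\<^sup>2) + cossq1 \<xi>)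
    - quartic_weight * ((1 - cossq1 \<xi>)\<^sup>2 - 2 * (4 - 4 * cossq1 \<xi> - (tan1 \<xi>)\<^sup>2) * (\<xi>$3)\<^sup>2
        + (1 - 6 * (tan1 \<xi>)\<^sup>2 + (tan1 \<xi>)^4) * (\<xi>$3)^4)"

definition pot1 :: "real \<Rightarrow> real^3 \<Rightarrow> real" where
  "pot1 e \<xi> = \<xi>$2 * \<xi>$3 * (1 + (tan1 \<xi>)\<^sup>2) - e * ((\<xi>$3)\<^sup>2 * tan1 \<xi> * (1 + (tan1 \<xi>)\<^sup>2) + tan1 \<xi> * cossq1 \<xi>)
    - quartic_weight * (4 * tan1 \<xi> * cossq1 \<xi> * (1 - cossq1 \<xi>)
        - 2 * (8 * tan1 \<xi> * cossq1 \<xi> - 2 * tan1 \<xi> * (1 + (tan1 \<xi>)\<^sup>2)) * (\<xi>$3)\<^sup>2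
        + (4 * (tan1 \<xi>)^3 - 12 * tan1 \<xi>) * (1 + (tan1 \<xi>)\<^sup>2) * (\<xi>$3)^4)"

definition pot2 :: "real^3 \<Rightarrow> real" where
  "pot2 \<xi> = \<xi>$3 * tan1 \<xi>"

definition pot3 :: "real \<Rightarrow> real^3 \<Rightarrow> real" where
  "pot3 e \<xi> = \<xi>$2 * tan1 \<xi> + e * \<xi>$3 * (1 - (tan1 \<xi>)\<^sup>2)
    - quartic_weight * (4 * (1 - 6 * (tan1 \<xi>)\<^sup>2 + (tan1 \<xi>)^4) * (\<xi>$3)^3
        - 4 * (4 - 4 * cossq1 \<xi> - (tan1 \<xi>)\<^sup>2) * \<xi>$3)"

definition pot11 :: "real \<Rightarrow> real^3 \<Rightarrow> real" where
  "pot11 e \<xi> = 2 * \<xi>$2 * \<xi>$3 * tan1 \<xi> * (1 + (tan1 \<xi>)\<^sup>2)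
    - e * ((\<xi>$3)\<^sup>2 * (1 + 3 * (tan1 \<xi>)\<^sup>2) * (1 + (tan1 \<xi>)\<^sup>2) + (1 - (tan1 \<xi>)\<^sup>2) * cossq1 \<xi>)
    - quartic_weight * (4 * (1 - (tan1 \<xi>)\<^sup>2) * cossq1 \<xi> * (1 - cossq1 \<xi>) + 8 * (tan1 \<xi>)\<^sup>2 * (cossq1 \<xi>)\<^sup>2
        - 2 * (8 * (1 - (tan1 \<xi>)\<^sup>2) * cossq1 \<xi> - 2 * (1 + 3 * (tan1 \<xi>)\<^sup>2) * (1 + (tan1 \<xi>)\<^sup>2)) * (\<xi>$3)\<^sup>2
        + ((12 * (tan1 \<xi>)\<^sup>2 - 12) * (1 + (tan1 \<xi>)\<^sup>2)\<^sup>2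
          + (4 * (tan1 \<xi>)^3 - 12 * tan1 \<xi>) * 2 * tan1 \<xi> * (1 + (tan1 \<xi>)\<^sup>2)) * (\<xi>$3)^4)"

definition pot12 :: "real^3 \<Rightarrow> real" where
  "pot12 \<xi> = \<xi>$3 * (1 + (tan1 \<xi>)\<^sup>2)"

definition pot13 :: "real \<Rightarrow> real^3 \<Rightarrow> real" where
  "pot13 e \<xi> = \<xi>$2 * (1 + (tan1 \<xi>)\<^sup>2) - 2 * e * \<xi>$3 * tan1 \<xi> * (1 + (tan1 \<xi>)\<^sup>2)
    - quartic_weight * (4 * (4 * (tan1 \<xi>)^3 - 12 * tan1 \<xi>) * (1 + (tan1 \<xi>)\<^sup>2) * (\<xi>$3)^3
        - 4 * (8 * tan1 \<xi> * cossq1 \<xi> - 2 * tan1 \<xi> * (1 + (tan1 \<xi>)\<^sup>2)) * \<xi>$3)"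

definition pot33 :: "real \<Rightarrow> real^3 \<Rightarrow> real" where
  "pot33 e \<xi> = e * (1 - (tan1 \<xi>)\<^sup>2)
    - quartic_weight * (12 * (1 - 6 * (tan1 \<xi>)\<^sup>2 + (tan1 \<xi>)^4) * (\<xi>$3)\<^sup>2 - 4 * (4 - 4 * cossq1 \<xi> - (tan1 \<xi>)\<^sup>2))"

context
  fixes \<xi> :: "real^3"
  assumes cos: "cos (\<xi> $ 1) \<noteq> 0"
begin

lemmas base_derivs = has_derivative_tan1[OF cos] has_derivative_cossq1[OF cos] has_derivative_nth

lemma has_derivative_pot:
  "(pot e has_derivative (\<lambda>h. pot1 e \<xi> * h$1 + pot2 \<xi> * h$2 + pot3 e \<xi> * h$3)) (at \<xi>)"
  unfolding pot_def[abs_def] pot1_def pot2_def pot3_def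
  by (rule has_derivative_eq_rhs, (rule derivative_intros base_derivs)+, rule ext)
     (simp add: power2_eq_square power3_eq_cube eval_nat_numeral field_simps)

lemma has_derivative_pot1:
  "(pot1 e has_derivative (\<lambda>h. pot11 e \<xi> * h$1 + pot12 \<xi> * h$2 + pot13 e \<xi> * h$3)) (at \<xi>)"
  unfolding pot1_def[abs_def] pot11_def pot12_def pot13_def
  by (rule has_derivative_eq_rhs, (rule derivative_intros base_derivs)+, rule ext)
     (simp add: power2_eq_square power3_eq_cube eval_nat_numeral field_simps)

lemma has_derivative_pot2:
  "(pot2 has_derivative (\<lambda>h. pot12 \<xi> * h$1 + tan1 \<xi> * h$3)) (at \<xi>)"
  unfolding pot2_def[abs_def] pot12_def
  by (rule has_derivative_eq_rhs, (rule derivative_intros base_derivs)+, rule ext)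
     (simp add: field_simps)

lemma has_derivative_pot3:
  "(pot3 e has_derivative (\<lambda>h. pot13 e \<xi> * h$1 + tan1 \<xi> * h$2 + pot33 e \<xi> * h$3)) (at \<xi>)"
  unfolding pot3_def[abs_def] pot13_def pot33_def
  by (rule has_derivative_eq_rhs, (rule derivative_intros base_derivs)+, rule ext)
     (simp add: power2_eq_square power3_eq_cube eval_nat_numeral field_simps)

end

text \<open>Phase \<open>0\<close> means \<open>tr V = det V\<close> for the Hessian \<open>V\<close> of \<open>pot\<close>.\<close>

lemma pot_special_lagrangian:
  "pot11 e \<xi> + pot33 e \<xi> =
    2 * pot12 \<xi> * pot13 e \<xi> * tan1 \<xi> - (pot12 \<xi>)\<^sup>2 * pot33 e \<xi> - (tan1 \<xi>)\<^sup>2 * pot11 e \<xi>"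
proof -
  have rel: "cossq1 \<xi> * (1 + (tan1 \<xi>)\<^sup>2) = 1" by (rule cossq1_tan1)
  show ?thesis unfolding pot11_def pot12_def pot13_def pot33_def using rel by algebra
qed

lemma smooth_on_tan1: "open U \<Longrightarrow> (\<And>\<xi>. \<xi> \<in> U \<Longrightarrow> cos (\<xi> $ 1) \<noteq> 0) \<Longrightarrow> smooth_on U tan1"
  unfolding tan1_def[abs_def] by (intro smooth_on_tan smooth_on_nth)

lemma smooth_on_cossq1: "open U \<Longrightarrow> (\<And>\<xi>. \<xi> \<in> U \<Longrightarrow> cos (\<xi> $ 1) \<noteq> 0) \<Longrightarrow> smooth_on U cossq1"
  unfolding cossq1_def[abs_def]
proof (intro smooth_on_inverse smooth_on_add smooth_on_const smooth_on_power smooth_on_tan1)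
  show "1 + (tan1 x)\<^sup>2 \<noteq> 0" for x using cossq1_tan1[of x] by auto
qed

lemma
  assumes U: "open U" "\<And>\<xi>. \<xi> \<in> U \<Longrightarrow> cos (\<xi> $ 1) \<noteq> 0"
  shows smooth_on_pot: "smooth_on U (pot e)"
    and smooth_on_pot1: "smooth_on U (pot1 e)"
    and smooth_on_pot2: "smooth_on U pot2"
    and smooth_on_pot3: "smooth_on U (pot3 e)"
  unfolding pot_def[abs_def] pot1_def[abs_def] pot2_def[abs_def] pot3_def[abs_def]
  by (intro smooth_on_add smooth_on_diff smooth_on_mult smooth_on_const smooth_on_nth
      smooth_on_power smooth_on_tan1 smooth_on_cossq1 U; assumption)+

section \<open>Estimates on a small cell\<close>

lemma cossq1_bounds: "0 < cossq1 \<xi>" "cossq1 \<xi> \<le> 1" "1 - cossq1 \<xi> = (tan1 \<xi>)\<^sup>2 * cossq1 \<xi>"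
proof -
  have "1 + (tan1 \<xi>)\<^sup>2 > 0" by (simp add: add_pos_nonneg)
  then show "0 < cossq1 \<xi>" by (simp add: cossq1_def)
  then have "cossq1 \<xi> * (tan1 \<xi>)\<^sup>2 \<ge> 0" by simp
  then show "cossq1 \<xi> \<le> 1" using cossq1_tan1[of \<xi>] unfolding distrib_left by linarith
  show "1 - cossq1 \<xi> = (tan1 \<xi>)\<^sup>2 * cossq1 \<xi>" using cossq1_tan1[of \<xi>] by (simp add: algebra_simps)
qed

text \<open>The side \<open>arctan \<rho>\<close> bounds \<open>tan1\<close> by
  \<open>\<rho>\<close> and keeps the cosine nonzero. A box is convex, so mean value arguments along
  segments stay inside.\<close>

definition closed_cell :: "real \<Rightarrow> (real^3) set" where
  "closed_cell \<rho> = {\<xi>. \<bar>\<xi>$1\<bar> \<le> arctan \<rho> \<and> \<bar>\<xi>$2\<bar> \<le> \<rho> \<and> \<bar>\<xi>$3\<bar> \<le> \<rho>}"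

definition open_cell :: "real \<Rightarrow> (real^3) set" where
  "open_cell \<rho> = {\<xi>. \<bar>\<xi>$1\<bar> < arctan \<rho> \<and> \<bar>\<xi>$2\<bar> < \<rho> \<and> \<bar>\<xi>$3\<bar> < \<rho>}"

lemma closed_cell_eq_cbox:
  "closed_cell \<rho> = cbox (vector [- arctan \<rho>, - \<rho>, - \<rho>]) (vector [arctan \<rho>, \<rho>, \<rho>])"
  by (auto simp: closed_cell_def mem_box_cart forall_3 abs_le_iff vector_3)

lemma open_cell_eq_box:
  "open_cell \<rho> = box (vector [- arctan \<rho>, - \<rho>, - \<rho>]) (vector [arctan \<rho>, \<rho>, \<rho>])"
  by (auto simp: open_cell_def mem_box_cart forall_3 abs_less_iff vector_3)

lemma compact_closed_cell: "compact (closed_cell \<rho>)" and convex_closed_cell: "convex (closed_cell \<rho>)"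
  by (simp_all add: closed_cell_eq_cbox compact_cbox convex_box)

lemma open_open_cell: "open (open_cell \<rho>)"
  by (simp add: open_cell_eq_box open_box)

lemma open_cell_subset: "open_cell \<rho> \<subseteq> closed_cell \<rho>"
  by (auto simp: open_cell_def closed_cell_def)

lemma zero_in_open_cell: "0 < \<rho> \<Longrightarrow> 0 \<in> open_cell \<rho>"
  by (simp add: open_cell_def)

lemma closed_cell_bounds:
  assumes "\<xi> \<in> closed_cell \<rho>"
  shows "cos (\<xi>$1) \<noteq> 0" "\<bar>tan1 \<xi>\<bar> \<le> \<rho>" "\<bar>\<xi>$2\<bar> \<le> \<rho>" "\<bar>\<xi>$3\<bar> \<le> \<rho>" "arctan (tan1 \<xi>) = \<xi>$1"
    "\<bar>\<xi>$1\<bar> \<le> \<rho>"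
proof -
  have x: "\<bar>\<xi>$1\<bar> \<le> arctan \<rho>" using assms by (simp add: closed_cell_def)
  then have lim: "- (pi/2) < \<xi>$1" "\<xi>$1 < pi/2"
    using arctan_ubound[of \<rho>] by linarith+
  then show "cos (\<xi>$1) \<noteq> 0" using cos_gt_zero_pi[of "\<xi>$1"] by simp
  show at: "arctan (tan1 \<xi>) = \<xi>$1" unfolding tan1_def using lim by (rule arctan_tan)
  have "arctan \<bar>tan1 \<xi>\<bar> \<le> arctan \<rho>"
    using x at by (simp add: abs_if arctan_minus split: if_splits)
  then show "\<bar>tan1 \<xi>\<bar> \<le> \<rho>" by (simp only: arctan_le_iff)
  then show "\<bar>\<xi>$1\<bar> \<le> \<rho>" using abs_arctan_le[of "tan1 \<xi>"] at by simp
qed (use assms in \<open>auto simp: closed_cell_def\<close>)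

text \<open>With \<open>c = cos \<alpha>\<close> and \<open>a = - sin \<alpha>\<close>, the maps \<open>base\<close> and \<open>fibre\<close> give the real and imaginary parts of
  the rotated graph.\<close>

definition base :: "real \<Rightarrow> real \<Rightarrow> real \<Rightarrow> real^3 \<Rightarrow> real^3" where
  "base a c e \<xi> = vector [- pot1 e \<xi>, c * \<xi>$2 + a * pot2 \<xi>, c * \<xi>$3 + a * pot3 e \<xi>]"

lemma base_nth:
  "base a c e \<xi> $ 1 = - pot1 e \<xi>"
  "base a c e \<xi> $ 2 = c * \<xi>$2 + a * pot2 \<xi>"
  "base a c e \<xi> $ 3 = c * \<xi>$3 + a * pot3 e \<xi>"
  by (simp_all add: base_def vector_3)

definition jac_base :: "real \<Rightarrow> real \<Rightarrow> real \<Rightarrow> real^3 \<Rightarrow> real^3^3" where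
  "jac_base a c e \<xi> = vector
    [vector [- pot11 e \<xi>, - pot12 \<xi>, - pot13 e \<xi>],
     vector [a * pot12 \<xi>, c, a * tan1 \<xi>],
     vector [a * pot13 e \<xi>, a * tan1 \<xi>, c + a * pot33 e \<xi>]]"

text \<open>The expansion separates \<open>pot11\<close>, multiplied by a minor close to
  \<open>c^2\<close>, from \<open>a\<close> times a quadratic form in \<open>pot12\<close> and
  \<open>pot13\<close> close to \<open>c * (pot12^2 + pot13^2)\<close>.\<close>

lemma det_jac_base: "det (jac_base a c e \<xi>) =
   - pot11 e \<xi> * (c * (c + a * pot33 e \<xi>) - (a * tan1 \<xi>)\<^sup>2)
    + a * ((pot12 \<xi>)\<^sup>2 * (c + a * pot33 e \<xi>) - 2 * a * tan1 \<xi> * pot12 \<xi> * pot13 e \<xi> + (pot13 e \<xi>)\<^sup>2 * c)"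
  by (simp add: det_3 jac_base_def vector_3 power2_eq_square algebra_simps)

text \<open>Only an upper bound is required. The \<open>e\<close> term and the part of the quartic
  term independent of \<open>x\<close> and \<open>y\<close> have the favourable sign and are
  dropped; the rest is a small multiple of \<open>x^2 + y^2\<close>, where
  \<open>1/500 + 30/100000 < 1/256\<close>.\<close>

lemma pot11_le:
  assumes "\<bar>tan1 \<xi>\<bar> \<le> 1/1000" "\<bar>\<xi>$3\<bar> \<le> 1" "0 \<le> e"
  shows "pot11 e \<xi> \<le> ((\<xi>$2)\<^sup>2 + (\<xi>$3)\<^sup>2) / 256"
proof -
  define s q x y where "s = tan1 \<xi>" and "q = cossq1 \<xi>" and "x = \<xi>$2" and "y = \<xi>$3"
  define w u where "w = s\<^sup>2" and "u = y\<^sup>2"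
  have s: "\<bar>s\<bar> \<le> 1/1000" using assms(1) s_def by simp
  have w: "0 \<le> w" "w \<le> 1/1000000"
    using power_mono[OF s, of 2] by (simp_all add: w_def power_divide)
  have u: "0 \<le> u" "u \<le> 1" using power_mono[OF assms(2), of 2] by (simp_all add: u_def y_def)
  have q: "0 < q" "q \<le> 1" using cossq1_bounds by (simp_all add: q_def)
  have "\<bar>2 * x * y\<bar> \<le> x\<^sup>2 + y\<^sup>2"
    using sum_squares_bound[of "\<bar>x\<bar>" "\<bar>y\<bar>"] by (simp add: abs_mult)
  moreover have "\<bar>s * (1 + w)\<bar> \<le> 1/1000 * 2"
    unfolding abs_mult using s w by (intro mult_mono) auto
  ultimately have "\<bar>(2 * x * y) * (s * (1 + w))\<bar> \<le> (x\<^sup>2 + y\<^sup>2) * (1/1000 * 2)"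
    unfolding abs_mult[of "2 * x * y"] by (intro mult_mono) auto
  moreover have "2 * x * y * s * (1 + w) = (2 * x * y) * (s * (1 + w))" by (simp add: mult.assoc)
  ultimately have t1: "2 * x * y * s * (1 + w) \<le> (x\<^sup>2 + y\<^sup>2) / 500" by linarith
  have t2: "e * (u * (1 + 3 * w) * (1 + w) + (1 - w) * q) \<ge> 0"
    using assms(3) w u q by (intro mult_nonneg_nonneg add_nonneg_nonneg) auto
  have p0: "4 * (1 - w) * q * (1 - q) + 8 * w * q\<^sup>2 \<ge> 0"
    using w q by (intro add_nonneg_nonneg mult_nonneg_nonneg) auto
  have "(1 - w) * q \<le> 1" using w q by (intro mult_le_one) auto
  moreover have "(1 + 3 * w) * (1 + w) \<ge> 0" using w by simp
  ultimately have f1: "8 * (1 - w) * q - 2 * (1 + 3 * w) * (1 + w) \<le> 8" by linarith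
  have "(12 * w - 12) * (1 + w)\<^sup>2 + (8 * w\<^sup>2 - 24 * w) * (1 + w) = - 12 - 36 * w - 4 * w\<^sup>2 + 20 * w^3"
    by (simp add: algebra_simps power2_eq_square power3_eq_cube)
  moreover have "w\<^sup>2 \<le> w" using w by (simp add: power2_eq_square mult_left_le)
  moreover have "w^3 \<ge> 0" using w by simp
  ultimately have f2: "(12 * w - 12) * (1 + w)\<^sup>2 + (8 * w\<^sup>2 - 24 * w) * (1 + w) \<ge> - 14"
    using w by linarith
  have "(8 * (1 - w) * q - 2 * (1 + 3 * w) * (1 + w)) * u \<le> 8 * u"
    using f1 u by (intro mult_right_mono) auto
  moreover have "((12 * w - 12) * (1 + w)\<^sup>2 + (8 * w\<^sup>2 - 24 * w) * (1 + w)) * u\<^sup>2 \<ge> - 14 * u\<^sup>2"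
    using f2 by (intro mult_right_mono) auto
  moreover have "u\<^sup>2 \<le> u" using u by (simp add: power2_eq_square mult_left_le)
  ultimately have t3: "4 * (1 - w) * q * (1 - q) + 8 * w * q\<^sup>2
      - 2 * ((8 * (1 - w) * q - 2 * (1 + 3 * w) * (1 + w)) * u)
      + ((12 * w - 12) * (1 + w)\<^sup>2 + (8 * w\<^sup>2 - 24 * w) * (1 + w)) * u\<^sup>2 \<ge> - 30 * u"
    using p0 by linarith
  have "pot11 e \<xi> = 2 * x * y * s * (1 + w) - e * (u * (1 + 3 * w) * (1 + w) + (1 - w) * q)
     - quartic_weight * (4 * (1 - w) * q * (1 - q) + 8 * w * q\<^sup>2
      - 2 * ((8 * (1 - w) * q - 2 * (1 + 3 * w) * (1 + w)) * u)
      + ((12 * w - 12) * (1 + w)\<^sup>2 + (8 * w\<^sup>2 - 24 * w) * (1 + w)) * u\<^sup>2)"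
    unfolding pot11_def s_def q_def x_def y_def w_def u_def
    by (simp add: eval_nat_numeral algebra_simps)
  also have "\<dots> \<le> (x\<^sup>2 + y\<^sup>2) / 500 - 0 - quartic_weight * (- 30 * u)"
    using t1 t2 t3 by (intro diff_mono mult_left_mono) (auto simp: quartic_weight_def)
  also have "\<dots> = (x\<^sup>2 + y\<^sup>2) / 500 + 30 / 100000 * u"
    by (simp add: quartic_weight_def)
  also have "\<dots> \<le> (x\<^sup>2 + y\<^sup>2) / 256"
    using zero_le_power2[of x] zero_le_power2[of y] unfolding u_def by (simp add: field_simps)
  finally show ?thesis by (simp add: x_def y_def)
qed

text \<open>On the axis the quartic term has the right sign but vanishes at the origin, so the
  strict sign comes from \<open>e > 0\<close>.\<close>

lemma pot11_axis_neg:
  assumes "\<bar>tan1 \<xi>\<bar> < 1" "\<xi>$2 = 0" "\<xi>$3 = 0" "0 < e"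
  shows "pot11 e \<xi> < 0"
proof -
  have w: "(tan1 \<xi>)\<^sup>2 < 1" using assms(1) by (simp add: abs_square_less_1)
  note q = cossq1_bounds(1,2)[of \<xi>]
  have "e * ((1 - (tan1 \<xi>)\<^sup>2) * cossq1 \<xi>) > 0" using w q assms(4) by simp
  moreover have "4 * (1 - (tan1 \<xi>)\<^sup>2) * cossq1 \<xi> * (1 - cossq1 \<xi>) + 8 * (tan1 \<xi>)\<^sup>2 * (cossq1 \<xi>)\<^sup>2 \<ge> 0"
    using w q by (intro add_nonneg_nonneg mult_nonneg_nonneg) auto
  ultimately show ?thesis
    unfolding pot11_def using assms(2,3) by (simp add: quartic_weight_def)
qed

text \<open>By \<open>1 - cossq1 = tan1^2 * cossq1\<close> every quartic contribution carries a
  factor \<open>tan1^2\<close> or \<open>y^2\<close> and amounts to at most \<open>r\<close>; the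
  \<open>e\<close> term contributes at most another \<open>r\<close>.\<close>

lemma pot33_le:
  assumes "\<bar>tan1 \<xi>\<bar> \<le> r" "\<bar>\<xi>$3\<bar> \<le> r" "0 \<le> e" "e \<le> r" "r \<le> 1/1000"
  shows "\<bar>pot33 e \<xi>\<bar> \<le> 2 * r"
proof -
  define w q u where "w = (tan1 \<xi>)\<^sup>2" and "q = cossq1 \<xi>" and "u = (\<xi>$3)\<^sup>2"
  have r: "0 \<le> r" using assms by simp
  have "r\<^sup>2 \<le> r / 1000" using mult_left_mono[OF assms(5) r] by (simp add: power2_eq_square)
  then have w: "0 \<le> w" "w \<le> r / 1000" and u: "0 \<le> u" "u \<le> r / 1000"
    using power_mono[OF assms(1), of 2] power_mono[OF assms(2), of 2]
    by (simp_all add: w_def u_def)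
  have q: "0 < q" "q \<le> 1" "1 - q = w * q" using cossq1_bounds[of \<xi>] by (simp_all add: q_def w_def)
  have wq: "0 \<le> w * q" "w * q \<le> w" using q w by (auto simp: mult_left_le)
  have "w\<^sup>2 \<le> 1" "0 \<le> w\<^sup>2" using w assms(5) by (auto intro!: power_le_one)
  then have "\<bar>1 - 6 * w + w\<^sup>2\<bar> \<le> 8" using w assms(5) by linarith
  then have "\<bar>(1 - 6 * w + w\<^sup>2) * u\<bar> \<le> 8 * (r / 1000)"
    unfolding abs_mult using u by (intro mult_mono) auto
  moreover have "\<bar>4 * (4 - 4 * q - w)\<bar> \<le> 20 * (r / 1000)"
    using wq q(3) w unfolding abs_le_iff by auto
  ultimately have "\<bar>12 * ((1 - 6 * w + w\<^sup>2) * u) - 4 * (4 - 4 * q - w)\<bar> \<le> r"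
    using r unfolding abs_le_iff by auto
  then have "\<bar>quartic_weight * (12 * ((1 - 6 * w + w\<^sup>2) * u) - 4 * (4 - 4 * q - w))\<bar> \<le> r"
    unfolding abs_mult[of quartic_weight] using r by (simp add: quartic_weight_def)
  moreover have "\<bar>e * (1 - w)\<bar> \<le> r * 1"
    unfolding abs_mult using assms w r by (intro mult_mono) auto
  moreover have "pot33 e \<xi> = e * (1 - w) - quartic_weight * (12 * ((1 - 6 * w + w\<^sup>2) * u) - 4 * (4 - 4 * q - w))"
    unfolding pot33_def w_def q_def u_def by simp
  ultimately show ?thesis by linarith
qed

text \<open>All corrections carry the factors \<open>y\<close> and \<open>tan1\<close> and a small
  coefficient \<open>e\<close> or \<open>quartic_weight\<close>. Thus \<open>(pot12, pot13)\<close>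
  is close to \<open>(1 + tan1^2) * (y, x)\<close>.\<close>

lemma pot13_approx:
  assumes "\<bar>tan1 \<xi>\<bar> \<le> r" "\<bar>\<xi>$3\<bar> \<le> 1" "0 \<le> e" "e \<le> r" "r \<le> 1/1000"
  shows "\<bar>pot13 e \<xi> - \<xi>$2 * (1 + (tan1 \<xi>)\<^sup>2)\<bar> \<le> \<bar>\<xi>$3\<bar> * r"
proof -
  define s w q y where "s = tan1 \<xi>" and "w = s\<^sup>2" and "q = cossq1 \<xi>" and "y = \<xi>$3"
  have r: "0 \<le> r" using assms by simp
  have s: "\<bar>s\<bar> \<le> r" using assms(1) by (simp add: s_def)
  then have "\<bar>s\<bar> \<le> 1" using assms(5) by simp
  then have w: "0 \<le> w" "w \<le> 1" by (simp_all add: w_def abs_square_le_1)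
  have u: "\<bar>y\<^sup>2\<bar> \<le> 1" using assms(2) by (simp add: y_def abs_square_le_1)
  have q: "0 < q" "q \<le> 1" using cossq1_bounds by (simp_all add: q_def)
  define A B C where "A = s * (1 + w)" and "B = s * q" and "C = s * ((4 * w - 12) * (1 + w))"
  have s1: "\<bar>A\<bar> \<le> r * 2" and s3: "\<bar>C\<bar> \<le> r * (12 * 2)" and s2: "\<bar>B\<bar> \<le> r * 1"
    unfolding abs_mult A_def B_def C_def using s w q r by (intro mult_mono; simp)+
  define T D where "T = e * 2 * A" and "D = C * y\<^sup>2"
  have "e * 2 \<le> 1/500" using assms by simp
  then have t1: "\<bar>T\<bar> \<le> 1/500 * (r * 2)"
    unfolding T_def abs_mult[of "e * 2"] using s1 assms(3) r by (intro mult_mono) auto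
  have "\<bar>D\<bar> \<le> r * (12 * 2) * 1"
    unfolding D_def abs_mult[of C] using s3 u r by (intro mult_mono) auto
  then have "\<bar>4 * D - 4 * (8 * B - 2 * A)\<bar> \<le> 200 * r"
    using s1 s2 r by (simp add: abs_le_iff)
  then have "\<bar>quartic_weight * (4 * D - 4 * (8 * B - 2 * A))\<bar> \<le> r / 2"
    using r by (simp add: abs_mult quartic_weight_def)
  then have "\<bar>- T - quartic_weight * (4 * D - 4 * (8 * B - 2 * A))\<bar> \<le> r"
    using t1 r abs_triangle_ineq4[of "- T" "quartic_weight * (4 * D - 4 * (8 * B - 2 * A))"]
    unfolding abs_minus_cancel by linarith
  then have "\<bar>y * (- T - quartic_weight * (4 * D - 4 * (8 * B - 2 * A)))\<bar> \<le> \<bar>y\<bar> * r"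
    unfolding abs_mult[of y] by (intro mult_left_mono) auto
  moreover have "pot13 e \<xi> - \<xi>$2 * (1 + (tan1 \<xi>)\<^sup>2) =
      y * (- T - quartic_weight * (4 * D - 4 * (8 * B - 2 * A)))"
    unfolding pot13_def T_def D_def A_def B_def C_def s_def w_def q_def y_def
    by (simp add: eval_nat_numeral algebra_simps)
  ultimately show ?thesis by (simp add: y_def)
qed

section \<open>The projection along the axis \<open>x = y = 0\<close>\<close>

text \<open>The profile, which is \<open>- pot1\<close> on the axis as a function of
  \<open>tan1\<close>, is a product of two increasing factors. The second is strictly increasing
  because \<open>quartic_weight > 0\<close>, even when \<open>e = 0\<close>.\<close>

lemma axis_profile_strict_mono:
  assumes "0 \<le> e" "0 \<le> t" "t < t'" "t' \<le> 1"
  shows "t / (1 + t\<^sup>2) * (e + 4 * quartic_weight * (t\<^sup>2 / (1 + t\<^sup>2))) < t' / (1 + t'\<^sup>2) * (e + 4 * quartic_weight * (t'\<^sup>2 / (1 + t'\<^sup>2)))"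
proof -
  have pos: "1 + t\<^sup>2 > 0" "1 + t'\<^sup>2 > 0" by (simp_all add: add_pos_nonneg)
  have tt: "t * t' < 1"
  proof -
    have "t * t' \<le> t * 1" using assms by (intro mult_left_mono) auto
    then show ?thesis using assms by simp
  qed
  then have "(t' - t) * (1 - t * t') > 0" using assms by simp
  then have "t * (1 + t'\<^sup>2) < t' * (1 + t\<^sup>2)" by (simp add: algebra_simps power2_eq_square)
  then have A: "t / (1 + t\<^sup>2) < t' / (1 + t'\<^sup>2)" using pos by (simp add: field_simps)
  have "t\<^sup>2 < t'\<^sup>2" using assms by (intro power_strict_mono) auto
  then have B: "t\<^sup>2 / (1 + t\<^sup>2) < t'\<^sup>2 / (1 + t'\<^sup>2)" using pos by (simp add: field_simps)
  show ?thesis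
  proof (rule mult_strict_mono)
    show "e + 4 * quartic_weight * (t\<^sup>2 / (1 + t\<^sup>2)) < e + 4 * quartic_weight * (t'\<^sup>2 / (1 + t'\<^sup>2))"
      using B by (intro add_strict_left_mono mult_strict_left_mono) (simp_all add: quartic_weight_def)
    show "0 < t' / (1 + t'\<^sup>2)" using assms pos by simp
    show "0 \<le> e + 4 * quartic_weight * (t\<^sup>2 / (1 + t\<^sup>2))" using assms by (simp add: quartic_weight_def)
  qed (rule A)
qed

lemma pot1_axis:
  assumes "\<xi>$2 = 0" "\<xi>$3 = 0"
  shows "pot1 e \<xi> = - (tan1 \<xi> / (1 + (tan1 \<xi>)\<^sup>2) * (e + 4 * quartic_weight * ((tan1 \<xi>)\<^sup>2 / (1 + (tan1 \<xi>)\<^sup>2))))"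
proof -
  have d: "t / (1 + (tan1 \<xi>)\<^sup>2) = t * cossq1 \<xi>" for t by (simp add: cossq1_def divide_inverse)
  show ?thesis
    unfolding pot1_def d cossq1_bounds(3)[symmetric] assms by (simp add: algebra_simps)
qed

text \<open>The profile is odd, so its strict monotonicity on \<open>[0, 1]\<close> extends to
  \<open>[-1, 1]\<close>.\<close>

lemma pot1_axis_inj:
  assumes "\<xi>$2 = 0" "\<xi>$3 = 0" "\<xi>'$2 = 0" "\<xi>'$3 = 0" "0 \<le> e" "\<bar>tan1 \<xi>\<bar> \<le> 1" "\<bar>tan1 \<xi>'\<bar> \<le> 1"
    and eq: "pot1 e \<xi> = pot1 e \<xi>'"
  shows "tan1 \<xi> = tan1 \<xi>'"
proof -
  define f where "f t = t / (1 + t\<^sup>2) * (e + 4 * quartic_weight * (t\<^sup>2 / (1 + t\<^sup>2)))" for t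
  have f: "f (tan1 \<xi>) = f (tan1 \<xi>')" using eq unfolding pot1_axis[OF assms(1,2)] pot1_axis[OF assms(3,4)] f_def neg_equal_iff_equal .
  have odd: "f (- t) = - f t" for t by (simp add: f_def)
  have mono: "f t < f t'" if "0 \<le> t" "t < t'" "t' \<le> 1" for t t'
    unfolding f_def using axis_profile_strict_mono[OF assms(5) that] .
  have "f 0 = 0" by (simp add: f_def)
  have less: "f t < f t'" if "t < t'" "\<bar>t\<bar> \<le> 1" "\<bar>t'\<bar> \<le> 1" for t t'
  proof -
    consider "0 \<le> t" | "t < 0" "t' \<le> 0" | "t < 0" "0 < t'" by linarith
    then show ?thesis
    proof cases
      case 1 then show ?thesis using mono[of t t'] that by simp
    next
      case 2 then show ?thesis using mono[of "- t'" "- t"] that odd by simp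
    next
      case 3
      then show ?thesis using mono[of 0 "- t"] mono[of 0 t'] that odd[of t] \<open>f 0 = 0\<close> by simp
    qed
  qed
  show ?thesis
    using f less[of "tan1 \<xi>" "tan1 \<xi>'"] less[of "tan1 \<xi>'" "tan1 \<xi>"] assms(6,7)
    by (cases "tan1 \<xi>" "tan1 \<xi>'" rule: linorder_cases) auto
qed

section \<open>Positivity of the Jacobian determinant\<close>

text \<open>The condition \<open>c \<le> a\<close> is
  \<open>\<bar>tan \<alpha>\<bar> \<ge> 1\<close>. The bound by \<open>c / 100\<close> makes
  \<open>a * tan1\<close> and \<open>a * pot33\<close> small compared with \<open>c\<close>; the
  bound by \<open>1 / 1000\<close> serves the estimates on the potential.\<close>

locale small_cell =
  fixes a c \<rho> :: real
  assumes c: "0 < c" "c \<le> a" and a: "a \<le> 1"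
    and \<rho>: "0 < \<rho>" "\<rho> \<le> c / 100" "\<rho> \<le> 1 / 1000"
begin

text \<open>With \<open>N = x^2 + y^2\<close>, the quadratic form in \<open>pot12\<close> and
  \<open>pot13\<close> contributes at least \<open>a * c * N / 4\<close>, while \<open>pot11\<close>
  costs at most \<open>c^2 * N / 128\<close>, which is smaller as \<open>c \<le> a\<close>. On the
  axis, where \<open>N = 0\<close>, the negative sign of \<open>pot11\<close> decides.\<close>

lemma det_jac_base_pos:
  assumes \<xi>: "\<xi> \<in> closed_cell \<rho>" and e: "0 < e" "e \<le> \<rho>"
  shows "det (jac_base a c e \<xi>) > 0"
proof -
  define s V12 V13 A33 N x y where "s = a * tan1 \<xi>" and "V12 = pot12 \<xi>" and "V13 = pot13 e \<xi>"
    and "A33 = a * pot33 e \<xi>" and "N = x\<^sup>2 + y\<^sup>2" and "x = \<xi>$2" and "y = \<xi>$3"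
  define E where "E = c * (c + A33) - s\<^sup>2"
  note b = closed_cell_bounds[OF \<xi>]
  have "\<bar>s\<bar> \<le> 1 * \<rho>"
    unfolding s_def abs_mult using a c b(2) by (intro mult_mono) auto
  then have s: "\<bar>s\<bar> \<le> c / 100" using \<rho> by simp
  have "\<bar>pot33 e \<xi>\<bar> \<le> 2 * \<rho>" using pot33_le[OF b(2,4)] e \<rho> by simp
  then have "\<bar>A33\<bar> \<le> 1 * (2 * \<rho>)"
    unfolding A33_def abs_mult using a c by (intro mult_mono) auto
  then have A33: "\<bar>A33\<bar> \<le> c / 50" using \<rho> by simp
  have s2: "s\<^sup>2 \<le> c\<^sup>2 / 10000" using power_mono[OF s, of 2] by (simp add: power_divide)
  have cA: "\<bar>c * A33\<bar> \<le> c * (c / 50)" unfolding abs_mult using A33 c by (intro mult_mono) auto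
  have "c * A33 \<le> c * (c / 50)" "- (c * A33) \<le> c * (c / 50)" using cA by (simp_all only: abs_le_iff)
  then have E: "0 < E" "E \<le> 2 * c\<^sup>2"
    using s2 zero_le_power2[of s] zero_less_power[OF c(1), of 2]
    unfolding E_def distrib_left power2_eq_square[of c] by linarith+
  have V12: "V12\<^sup>2 \<ge> y\<^sup>2"
  proof -
    have "y\<^sup>2 * 1 \<le> y\<^sup>2 * (1 + (tan1 \<xi>)\<^sup>2)\<^sup>2" by (intro mult_left_mono one_le_power) auto
    then show ?thesis by (simp add: V12_def pot12_def y_def power_mult_distrib)
  qed
  have V13: "V13\<^sup>2 \<ge> x\<^sup>2 / 2 - y\<^sup>2 / 4"
  proof -
    define p h where "p = x * (1 + (tan1 \<xi>)\<^sup>2)" and "h = V13 - p"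
    have "x\<^sup>2 * 1 \<le> x\<^sup>2 * (1 + (tan1 \<xi>)\<^sup>2)\<^sup>2" by (intro mult_left_mono one_le_power) auto
    then have p: "x\<^sup>2 \<le> p\<^sup>2" by (simp add: p_def power_mult_distrib)
    have "\<bar>h\<bar> \<le> \<bar>y\<bar> * \<rho>"
      using pot13_approx[OF b(2), of e] b(4) e \<rho> by (simp add: h_def p_def V13_def x_def y_def)
    also have "\<dots> \<le> \<bar>y\<bar> * (1/2)" using \<rho> by (intro mult_left_mono) auto
    finally have "\<bar>h\<bar> \<le> \<bar>y / 2\<bar>" by simp
    then have h: "h\<^sup>2 \<le> y\<^sup>2 / 4" by (simp only: abs_le_square_iff power_divide) simp
    \<comment> \<open>Writing \<open>V13 = p + h\<close> and completing the square gives
      \<open>V13^2 \<ge> p^2 / 2 - h^2\<close>.\<close>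
    have "V13\<^sup>2 = p\<^sup>2 / 2 - h\<^sup>2 + (p + 2 * h)\<^sup>2 / 2"
      unfolding h_def by (simp add: power2_eq_square field_simps)
    then show ?thesis using p h zero_le_power2[of "p + 2 * h"] by linarith
  qed
  \<comment> \<open>Naming the products turns the remaining comparison into linear
    arithmetic.\<close>
  define P Q X Y Z L where "P = c * V12\<^sup>2" and "Q = c * V13\<^sup>2" and "X = c * x\<^sup>2" and "Y = c * y\<^sup>2"
    and "Z = V12\<^sup>2 * (c + A33)" and "L = s * (2 * V12 * V13)"
  have "Z \<ge> V12\<^sup>2 * (c - c / 50)"
    unfolding Z_def using A33 by (intro mult_left_mono) auto
  then have Z: "Z \<ge> P - P / 50" by (simp add: P_def algebra_simps)
  have "\<bar>L\<bar> \<le> (c / 100) * (V12\<^sup>2 + V13\<^sup>2)"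
    using sum_squares_bound[of "\<bar>V12\<bar>" "\<bar>V13\<bar>"] s
    unfolding L_def abs_mult[of s] by (intro mult_mono) (auto simp: abs_mult)
  then have L: "L \<le> P / 100 + Q / 100" by (simp add: P_def Q_def algebra_simps)
  have "c * (x\<^sup>2 / 2 - y\<^sup>2 / 4) \<le> Q" unfolding Q_def using c V13 by (intro mult_left_mono) auto
  then have Q: "X / 2 - Y / 4 \<le> Q" by (simp add: X_def Y_def algebra_simps)
  have "P \<ge> Y" "Q \<ge> 0" "Y \<ge> 0" using c V12 by (auto simp: P_def Q_def Y_def)
  then have "Z - L + Q \<ge> (X + Y) / 4" using Z L Q by argo
  then have B: "V12\<^sup>2 * (c + A33) - 2 * s * V12 * V13 + V13\<^sup>2 * c \<ge> c * N / 4"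
    by (simp add: N_def X_def Y_def Z_def L_def Q_def algebra_simps)
  have dt: "det (jac_base a c e \<xi>) = - pot11 e \<xi> * E + a * (V12\<^sup>2 * (c + A33) - 2 * s * V12 * V13 + V13\<^sup>2 * c)"
    by (simp add: det_jac_base E_def s_def A33_def V12_def V13_def power_mult_distrib)
  have aB: "a * (V12\<^sup>2 * (c + A33) - 2 * s * V12 * V13 + V13\<^sup>2 * c) \<ge> a * (c * N / 4)"
    using B c by (intro mult_left_mono) auto
  have V11: "pot11 e \<xi> \<le> N / 256"
    using pot11_le[of \<xi> e] b(2,4) e \<rho> by (simp add: N_def x_def y_def)
  show ?thesis
  proof (cases "N = 0")
    case True
    then have "x = 0" "y = 0" by (auto simp: N_def sum_power2_eq_zero_iff)
    then have "pot11 e \<xi> < 0"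
      using pot11_axis_neg[of \<xi> e] b(2) \<rho> e by (simp add: x_def y_def)
    then have "- pot11 e \<xi> * E > 0" using E(1) by (simp add: mult_neg_pos)
    then show ?thesis using dt aB True by simp
  next
    case False
    then have N: "N > 0" using sum_power2_gt_zero_iff[of x y] by (auto simp: N_def)
    have "pot11 e \<xi> * E \<le> N / 256 * E" using V11 E by (intro mult_right_mono) auto
    also have "\<dots> \<le> N / 256 * (2 * c\<^sup>2)" using N E by (intro mult_left_mono) auto
    also have "\<dots> = c * (c * N) / 128" by (simp add: power2_eq_square)
    also have "\<dots> \<le> a * (c * N) / 128" using c N by (intro divide_right_mono mult_right_mono) auto
    also have "\<dots> < a * (c * N / 4)" using c N by simp
    finally show ?thesis using dt aB by simp
  qed
qed

end

section \<open>Injectivity of the projection\<close>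

text \<open>Rolle's theorem on the segment. It is meant for scalar combinations of the components of
  \<open>base\<close>, since a vector-valued map need not have a common mean value point.\<close>

lemma has_derivative_critical_on_segment:
  fixes f :: "'a::real_normed_vector \<Rightarrow> real"
  assumes "convex K" "x \<in> K" "y \<in> K" "\<And>z. z \<in> K \<Longrightarrow> (f has_derivative f' z) (at z)" "f x = f y"
  obtains t where "0 \<le> t" "t \<le> 1" "y + t *\<^sub>R (x - y) \<in> K" "f' (y + t *\<^sub>R (x - y)) (x - y) = 0"
proof -
  have K: "y + t *\<^sub>R (x - y) \<in> K" if "t \<in> {0..1}" for t
  proof -
    have "y + t *\<^sub>R (x - y) = (1 - t) *\<^sub>R y + t *\<^sub>R x" by (simp add: algebra_simps)
    then show ?thesis using that convexD_alt[OF assms(1,3,2), of t] by simp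
  qed
  have "((\<lambda>t. f (y + t *\<^sub>R (x - y))) has_derivative (\<lambda>h. f' (y + t *\<^sub>R (x - y)) (h *\<^sub>R (x - y)))) (at t within {0..1})"
    if "t \<in> {0..1}" for t
  proof -
    have "((\<lambda>t. y + t *\<^sub>R (x - y)) has_derivative (\<lambda>h. h *\<^sub>R (x - y))) (at t within {0..1})"
      by (auto intro!: derivative_eq_intros)
    from has_derivative_compose[OF this, of f, OF assms(4)[OF K[OF that]]] show ?thesis .
  qed
  then have "\<exists>t\<in>{0..1}. f (y + 1 *\<^sub>R (x - y)) - f (y + 0 *\<^sub>R (x - y)) =
      f' (y + t *\<^sub>R (x - y)) ((1 - 0) *\<^sub>R (x - y))"
    by (intro mvt_very_simple) auto
  then show ?thesis using that K assms(5) by auto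
qed

text \<open>Here \<open>s\<close>, \<open>A\<close> and \<open>V\<close> stand for
  \<open>a * tan1\<close>, \<open>a * pot33\<close> and \<open>pot11\<close> at a point of the
  segment. The left side of \<open>eq\<close> is at least \<open>97/100 * c * m\<close>; the right
  side is at most \<open>a * ds^2 * (N + m) / 128\<close>, whose \<open>m\<close> part is absorbed
  by the bound on \<open>ds^2\<close>. So the displacement in \<open>x\<close> and \<open>y\<close>
  is small relative to \<open>ds\<close>.\<close>

lemma weighted_estimate_1:
  fixes a c :: real
  assumes "0 < c" "0 < a" "a \<le> 1" and s: "\<bar>s\<bar> \<le> c / 100" and A: "\<bar>A\<bar> \<le> c / 50"
    and V: "V \<le> Nz / 256" and Nz: "Nz \<le> 2 * N + 2 * m" and m: "m = dx\<^sup>2 + dy\<^sup>2"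
    and ds: "ds\<^sup>2 \<le> c / 1000"
    and eq: "c * m + 2 * s * dx * dy + A * dy\<^sup>2 = a * V * ds\<^sup>2"
  shows "32 * c * m \<le> a * ds\<^sup>2 * N"
proof -
  have m0: "0 \<le> m" by (simp add: m)
  have "\<bar>s * (2 * dx * dy)\<bar> \<le> (c / 100) * m"
    using sum_squares_bound[of "\<bar>dx\<bar>" "\<bar>dy\<bar>"] s
    unfolding abs_mult[of s] by (intro mult_mono) (auto simp: abs_mult m)
  then have 1: "- (s * (2 * dx * dy)) \<le> c * m / 100" by (simp add: abs_le_iff)
  have "\<bar>A * dy\<^sup>2\<bar> \<le> (c / 50) * m" unfolding abs_mult using A by (intro mult_mono) (auto simp: m)
  then have 2: "- (A * dy\<^sup>2) \<le> c * m / 50" by (simp add: abs_le_iff)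
  have "a * V * ds\<^sup>2 \<le> a * ((2 * N + 2 * m) / 256) * ds\<^sup>2"
    using assms by (intro mult_right_mono mult_left_mono) auto
  also have "\<dots> = a * ds\<^sup>2 * N / 128 + a * ds\<^sup>2 * m / 128" by (simp add: field_simps)
  finally have 3: "a * V * ds\<^sup>2 \<le> a * ds\<^sup>2 * N / 128 + a * ds\<^sup>2 * m / 128" .
  have "a * ds\<^sup>2 * m \<le> 1 * (c / 1000) * m"
    using assms m0 by (intro mult_right_mono mult_mono) auto
  then have 4: "a * ds\<^sup>2 * m \<le> c * m / 1000" by simp
  have "c * m \<ge> 0" using assms(1) m0 by simp
  have 5: "c * m + s * (2 * dx * dy) + A * dy\<^sup>2 = a * V * ds\<^sup>2" using eq by (simp add: mult_ac)
  define X1 X2 X3 X4 X5 X6 where "X1 = s * (2 * dx * dy)" and "X2 = A * dy\<^sup>2" and "X3 = a * V * ds\<^sup>2"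
    and "X4 = a * ds\<^sup>2 * N" and "X5 = a * ds\<^sup>2 * m" and "X6 = c * m"
  have "32 * X6 \<le> X4"
    using 1 2 3 4 5 \<open>c * m \<ge> 0\<close> unfolding X1_def[symmetric] X2_def[symmetric] X3_def[symmetric]
      X4_def[symmetric] X5_def[symmetric] X6_def[symmetric] by argo
  then show ?thesis by (simp add: X4_def X6_def)
qed

text \<open>Cauchy-Schwarz in \<open>eq\<close> and the first estimate bound
  \<open>(a * ds * S)^2\<close> by \<open>3/32 * a^2 * ds^2 * N^2\<close>, using
  \<open>c \<le> a\<close>. But \<open>S \<ge> N / 2\<close> makes it at least \<open>1/4\<close> of
  the same product, so that product vanishes.\<close>

lemma weighted_estimate_2:
  fixes a c :: real
  assumes c: "0 < c" "c \<le> a" and s: "\<bar>s\<bar> \<le> c / 100" and A: "\<bar>A\<bar> \<le> c / 50"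
    and N: "N = x\<^sup>2 + y\<^sup>2" and m: "m = dx\<^sup>2 + dy\<^sup>2"
    and S: "N / 2 \<le> S"
    and eq: "a * ds * S + c * (y * dx + x * dy) + s * (y * dy + x * dx) + A * x * dy = 0"
    and 1: "32 * c * m \<le> a * ds\<^sup>2 * N"
  shows "ds = 0 \<or> N = 0"
proof (rule ccontr)
  assume "\<not> ?thesis"
  then have ds: "ds\<^sup>2 > 0" and N0: "N > 0" by (auto simp: N sum_power2_gt_zero_iff sum_power2_eq_zero_iff)
  define U W where "U = c * y + s * x" and "W = (c + A) * x + s * y"
  have T: "a * ds * S = - (dx * U + dy * W)" using eq by (simp add: U_def W_def algebra_simps)
  have s2: "s\<^sup>2 \<le> c\<^sup>2 / 10000" using power_mono[OF s, of 2] by (simp add: power_divide)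
  have "\<bar>c + A\<bar> \<le> 51 / 50 * c" using A c by linarith
  then have "(c + A)\<^sup>2 \<le> (51 / 50 * c)\<^sup>2" by (rule abs_le_square_iff[THEN iffD1, OF order_trans]) (use c in simp)
  also have "\<dots> = 2601 / 2500 * c\<^sup>2" by (simp add: power2_eq_square)
  finally have cA: "(c + A)\<^sup>2 \<le> 2601 / 2500 * c\<^sup>2" .
  have U: "U\<^sup>2 \<le> 2 * (c * y)\<^sup>2 + 2 * (s * x)\<^sup>2"
    using sum_squares_bound[of "c * y" "s * x"] unfolding U_def power2_sum by simp
  have W: "W\<^sup>2 \<le> 2 * ((c + A) * x)\<^sup>2 + 2 * (s * y)\<^sup>2"
    using sum_squares_bound[of "(c + A) * x" "s * y"] unfolding W_def power2_sum by simp
  have "(s * x)\<^sup>2 \<le> c\<^sup>2 / 10000 * x\<^sup>2" "(s * y)\<^sup>2 \<le> c\<^sup>2 / 10000 * y\<^sup>2"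
    "((c + A) * x)\<^sup>2 \<le> 2601 / 2500 * c\<^sup>2 * x\<^sup>2"
    unfolding power_mult_distrib[of s] power_mult_distrib[of "c + A"] using s2 cA by (intro mult_right_mono; simp)+
  then have sx: "(s * x)\<^sup>2 \<le> (c\<^sup>2 * x\<^sup>2) / 10000" and sy: "(s * y)\<^sup>2 \<le> (c\<^sup>2 * y\<^sup>2) / 10000"
    and cx: "((c + A) * x)\<^sup>2 \<le> 2601 / 2500 * (c\<^sup>2 * x\<^sup>2)" by simp_all
  have "(c * y)\<^sup>2 = c\<^sup>2 * y\<^sup>2" "c\<^sup>2 * x\<^sup>2 \<ge> 0" "c\<^sup>2 * y\<^sup>2 \<ge> 0" by (simp_all add: power_mult_distrib)
  then have "U\<^sup>2 + W\<^sup>2 \<le> 3 * (c\<^sup>2 * x\<^sup>2) + 3 * (c\<^sup>2 * y\<^sup>2)"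
    using U W sx sy cx by argo
  then have UW: "U\<^sup>2 + W\<^sup>2 \<le> 3 * c\<^sup>2 * N" by (simp add: N algebra_simps)
  \<comment> \<open>Lagrange's identity, with the square that Cauchy-Schwarz discards.\<close>
  have "(a * ds * S)\<^sup>2 = m * (U\<^sup>2 + W\<^sup>2) - (dx * W - dy * U)\<^sup>2"
    unfolding T m by (simp add: power2_eq_square algebra_simps)
  also have "\<dots> \<le> m * (U\<^sup>2 + W\<^sup>2)" by simp
  also have "\<dots> \<le> m * (3 * c\<^sup>2 * N)" using UW by (intro mult_left_mono) (simp_all add: m)
  also have "\<dots> = (32 * c * m) * (3 * c * N) / 32" by (simp add: power2_eq_square)
  also have "\<dots> \<le> (a * ds\<^sup>2 * N) * (3 * c * N) / 32"
    using 1 c N0 by (intro divide_right_mono mult_right_mono) auto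
  also have "\<dots> \<le> (a * ds\<^sup>2 * N) * (3 * a * N) / 32"
    using c N0 by (intro divide_right_mono mult_left_mono mult_right_mono) auto
  also have "\<dots> = (a\<^sup>2 * ds\<^sup>2 * N\<^sup>2) * (3 / 32)" by (simp add: power2_eq_square)
  finally have up: "(a * ds * S)\<^sup>2 \<le> (a\<^sup>2 * ds\<^sup>2 * N\<^sup>2) * (3 / 32)" .
  have "(N / 2)\<^sup>2 \<le> S\<^sup>2" using S N0 by (intro power_mono) auto
  then have "a\<^sup>2 * ds\<^sup>2 * (N / 2)\<^sup>2 \<le> a\<^sup>2 * ds\<^sup>2 * S\<^sup>2" by (intro mult_left_mono) auto
  then have "(a\<^sup>2 * ds\<^sup>2 * N\<^sup>2) / 4 \<le> (a * ds * S)\<^sup>2" by (simp add: power_mult_distrib power_divide)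
  moreover have "a\<^sup>2 * ds\<^sup>2 * N\<^sup>2 > 0" using c ds N0 by simp
  ultimately show False using up by linarith
qed

text \<open>This supplies the lower bound on \<open>S\<close> in \<open>weighted_estimate_2\<close>,
  with \<open>k = 1 + tan1^2\<close> and \<open>h\<close> the error in \<open>pot13_approx\<close>.
  As \<open>m\<close> is tiny compared with \<open>N\<close>, moving along the segment barely
  changes \<open>(x, y)\<close>.\<close>

lemma mixed_estimate:
  fixes x y dx dy :: real
  assumes N: "N = x\<^sup>2 + y\<^sup>2" and m: "m = dx\<^sup>2 + dy\<^sup>2" and small: "m \<le> N / 32000"
    and t: "0 \<le> t" "t \<le> 1" and k: "1 \<le> k" and r: "0 \<le> r" "r \<le> 1 / 1000"
    and h: "\<bar>h\<bar> \<le> \<bar>y + t * dy\<bar> * r"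
  shows "N / 2 \<le> y * (k * (y + t * dy)) + x * (k * (x + t * dx) + h)"
proof -
  have N0: "0 \<le> N" "0 \<le> m" by (simp_all add: N m)
  \<comment> \<open>Young's inequality, weighted so that \<open>50 * m\<close> is still negligible
    against \<open>N\<close> under \<open>small\<close>.\<close>
  have bd: "\<bar>p * q\<bar> \<le> p\<^sup>2 / 200 + 50 * q\<^sup>2" for p q :: real
  proof -
    have "0 \<le> (\<bar>p\<bar> / 10 - 10 * \<bar>q\<bar>)\<^sup>2" by simp
    then show ?thesis by (simp add: power2_diff power_divide power_mult_distrib abs_mult)
  qed
  have "\<bar>y * dy + x * dx\<bar> \<le> N / 200 + 50 * m"
    using bd[of y dy] bd[of x dx] unfolding N m abs_le_iff by argo
  then have "\<bar>y * dy + x * dx\<bar> \<le> N / 100" using small N0 by linarith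
  then have "\<bar>t * (y * dy + x * dx)\<bar> \<le> 1 * (N / 100)"
    unfolding abs_mult[of t] using t by (intro mult_mono) auto
  moreover have "y * (y + t * dy) + x * (x + t * dx) = N + t * (y * dy + x * dx)"
    by (simp add: N power2_eq_square algebra_simps)
  ultimately have i: "y * (y + t * dy) + x * (x + t * dx) \<ge> 99 / 100 * N"
    unfolding abs_le_iff by argo
  then have "1 * (99 / 100 * N) \<le> k * (y * (y + t * dy) + x * (x + t * dx))"
    using k N0 by (intro mult_mono) auto
  moreover have "\<bar>x * h\<bar> \<le> N / 4"
  proof -
    have "\<bar>t * dy\<bar> \<le> 1 * \<bar>dy\<bar>" unfolding abs_mult[of t] using t by (intro mult_right_mono) auto
    then have "\<bar>y + t * dy\<bar> \<le> \<bar>y\<bar> + \<bar>dy\<bar>" by linarith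
    then have "\<bar>x\<bar> * \<bar>h\<bar> \<le> \<bar>x\<bar> * ((\<bar>y\<bar> + \<bar>dy\<bar>) * r)"
      using h mult_right_mono[of _ _ r] r by (intro mult_left_mono) (auto intro: order_trans)
    also have "\<dots> = (\<bar>x * y\<bar> + \<bar>x * dy\<bar>) * r" by (simp add: abs_mult algebra_simps)
    also have "\<dots> \<le> (\<bar>x * y\<bar> + \<bar>x * dy\<bar>) * (1 / 1000)" using r by (intro mult_left_mono) auto
    also have "\<bar>x * dy\<bar> \<le> x\<^sup>2 / 200 + 50 * dy\<^sup>2" by (rule bd)
    also have "\<bar>x * y\<bar> \<le> x\<^sup>2 / 200 + 50 * y\<^sup>2" by (rule bd)
    also have "(x\<^sup>2 / 200 + 50 * y\<^sup>2 + (x\<^sup>2 / 200 + 50 * dy\<^sup>2)) * (1 / 1000) \<le> (50 * N + 50 * m + N) * (1 / 1000)"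
      by (simp add: N m)
    also have "\<dots> \<le> N / 4" using small N0 by simp
    finally show ?thesis by (simp add: abs_mult)
  qed
  ultimately have "k * (y * (y + t * dy) + x * (x + t * dx)) + x * h \<ge> N / 2"
    using N0 by (simp add: abs_le_iff)
  then show ?thesis by (simp add: algebra_simps)
qed

context small_cell
begin

lemma closed_cell_small:
  assumes "\<xi> \<in> closed_cell \<rho>" "0 \<le> e" "e \<le> \<rho>"
  shows "\<bar>a * tan1 \<xi>\<bar> \<le> c / 100" "\<bar>a * pot33 e \<xi>\<bar> \<le> c / 50"
proof -
  note b = closed_cell_bounds[OF assms(1)]
  have "\<bar>a * tan1 \<xi>\<bar> \<le> 1 * \<rho>"
    unfolding abs_mult using a c b(2) by (intro mult_mono) auto
  then show "\<bar>a * tan1 \<xi>\<bar> \<le> c / 100" using \<rho> by simp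
  have "\<bar>pot33 e \<xi>\<bar> \<le> 2 * \<rho>" using pot33_le[OF b(2,4)] assms \<rho> by simp
  then have "\<bar>a * pot33 e \<xi>\<bar> \<le> 1 * (2 * \<rho>)"
    unfolding abs_mult using a c by (intro mult_mono) auto
  then show "\<bar>a * pot33 e \<xi>\<bar> \<le> c / 50" using \<rho> by simp
qed

text \<open>For two points with the same image, Rolle's theorem is applied to two combinations of
  the components. The first bounds the displacement in \<open>x\<close> and \<open>y\<close> by that
  in the first coordinate; the second then forces \<open>ds = 0\<close> or \<open>N = 0\<close>.
  What remains is two points on the axis, separated by \<open>pot1_axis_inj\<close>.\<close>

lemma inj_on_base:
  assumes e: "0 \<le> e" "e \<le> \<rho>"
  shows "inj_on (base a c e) (closed_cell \<rho>)"
proof (rule inj_onI)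
  fix \<xi> \<xi>' assume cell: "\<xi> \<in> closed_cell \<rho>" "\<xi>' \<in> closed_cell \<rho>" and eq: "base a c e \<xi> = base a c e \<xi>'"
  define ds dx dy x y where "ds = (\<xi> - \<xi>')$1" and "dx = (\<xi> - \<xi>')$2" and "dy = (\<xi> - \<xi>')$3"
    and "x = \<xi>'$2" and "y = \<xi>'$3"
  define N m where "N = x\<^sup>2 + y\<^sup>2" and "m = dx\<^sup>2 + dy\<^sup>2"
  note bs = closed_cell_bounds[OF cell(1)] closed_cell_bounds[OF cell(2)]
  have a0: "0 < a" using c by simp
  have e1: "pot1 e \<xi> = pot1 e \<xi>'" and e2: "c * \<xi>$2 + a * pot2 \<xi> = c * \<xi>'$2 + a * pot2 \<xi>'"
    and e3: "c * \<xi>$3 + a * pot3 e \<xi> = c * \<xi>'$3 + a * pot3 e \<xi>'"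
    using arg_cong[OF eq, of "\<lambda>v. v$1"] arg_cong[OF eq, of "\<lambda>v. v$2"] arg_cong[OF eq, of "\<lambda>v. v$3"]
    by (simp_all add: base_nth)
  have "\<bar>ds\<bar> \<le> 2 * \<rho>" using bs(6,12) by (simp add: ds_def)
  then have "ds\<^sup>2 \<le> (2 * \<rho>)\<^sup>2" using power_mono[of "\<bar>ds\<bar>" "2 * \<rho>" 2] by simp
  also have "\<dots> \<le> 4 * (c / 100) * (1/1000)"
    using mult_mono[of \<rho> "c / 100" \<rho> "1/1000"] \<rho> c by (simp add: power2_eq_square)
  also have "\<dots> \<le> c / 1000" using c by simp
  finally have ds: "ds\<^sup>2 \<le> c / 1000" .
  \<comment> \<open>With these weights the terms containing \<open>pot12\<close> and \<open>pot13\<close> cancel in the derivative along the segment.\<close>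
  define f1 where "f1 z = - a * ds * pot1 e z + dx * (c * z$2 + a * pot2 z) + dy * (c * z$3 + a * pot3 e z)" for z
  have f1: "(f1 has_derivative (\<lambda>h. - a * ds * (pot11 e z * h$1 + pot12 z * h$2 + pot13 e z * h$3)
      + dx * (c * h$2 + a * (pot12 z * h$1 + tan1 z * h$3))
      + dy * (c * h$3 + a * (pot13 e z * h$1 + tan1 z * h$2 + pot33 e z * h$3)))) (at z)"
    if "z \<in> closed_cell \<rho>" for z
    unfolding f1_def[abs_def] using closed_cell_bounds(1)[OF that]
    by (intro has_derivative_add has_derivative_mult_right has_derivative_pot1 has_derivative_pot2
        has_derivative_pot3 has_derivative_nth)
  have "f1 \<xi> = f1 \<xi>'" unfolding f1_def e1 e2 e3 ..
  then obtain t where t: "0 \<le> t" "t \<le> 1" and z: "\<xi>' + t *\<^sub>R (\<xi> - \<xi>') \<in> closed_cell \<rho>"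
    and crit: "- a * ds * (pot11 e (\<xi>' + t *\<^sub>R (\<xi> - \<xi>')) * ds + pot12 (\<xi>' + t *\<^sub>R (\<xi> - \<xi>')) * dx
        + pot13 e (\<xi>' + t *\<^sub>R (\<xi> - \<xi>')) * dy)
      + dx * (c * dx + a * (pot12 (\<xi>' + t *\<^sub>R (\<xi> - \<xi>')) * ds + tan1 (\<xi>' + t *\<^sub>R (\<xi> - \<xi>')) * dy))
      + dy * (c * dy + a * (pot13 e (\<xi>' + t *\<^sub>R (\<xi> - \<xi>')) * ds + tan1 (\<xi>' + t *\<^sub>R (\<xi> - \<xi>')) * dx
        + pot33 e (\<xi>' + t *\<^sub>R (\<xi> - \<xi>')) * dy)) = 0"
    using has_derivative_critical_on_segment[OF convex_closed_cell cell f1]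
    unfolding ds_def dx_def dy_def by blast
  let ?z = "\<xi>' + t *\<^sub>R (\<xi> - \<xi>')"
  have sq: "(p + t * q)\<^sup>2 \<le> 2 * p\<^sup>2 + 2 * q\<^sup>2" for p q
  proof -
    have "\<bar>t * q\<bar> \<le> 1 * \<bar>q\<bar>" unfolding abs_mult using t by (intro mult_right_mono) auto
    then have "(t * q)\<^sup>2 \<le> q\<^sup>2" by (simp add: abs_le_square_iff[symmetric])
    moreover have "(p + t * q)\<^sup>2 \<le> 2 * p\<^sup>2 + 2 * (t * q)\<^sup>2"
      using sum_squares_bound[of p "t * q"] unfolding power2_sum by simp
    ultimately show ?thesis by linarith
  qed
  have est1: "32 * c * m \<le> a * ds\<^sup>2 * N"
  proof (rule weighted_estimate_1[OF c(1) a0 a closed_cell_small[OF z e]])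
    show "pot11 e ?z \<le> ((?z$2)\<^sup>2 + (?z$3)\<^sup>2) / 256"
      using pot11_le[of ?z e] closed_cell_bounds[OF z] e \<rho> by simp
    show "(?z$2)\<^sup>2 + (?z$3)\<^sup>2 \<le> 2 * N + 2 * m"
      using sq[of x dx] sq[of y dy] by (simp add: N_def m_def x_def y_def dx_def dy_def)
    show "m = dx\<^sup>2 + dy\<^sup>2" by (rule m_def)
    show "ds\<^sup>2 \<le> c / 1000" by (rule ds)
    show "c * m + 2 * (a * tan1 ?z) * dx * dy + a * pot33 e ?z * dy\<^sup>2 = a * pot11 e ?z * ds\<^sup>2"
      using crit by (simp add: m_def power2_eq_square algebra_simps)
  qed
  have "a * ds\<^sup>2 * N \<le> 1 * (c / 1000) * N"
    using a c ds by (intro mult_right_mono mult_mono) (auto simp: N_def)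
  then have "c * (32 * m) \<le> c * (N / 1000)" using est1 by simp
  then have small: "m \<le> N / 32000" using c by simp
  \<comment> \<open>These weights turn the mixed terms into \<open>a * ds * N\<close> to leading order, which \<open>est1\<close> makes too large unless
    \<open>ds = 0\<close> or \<open>N = 0\<close>.\<close>
  define f2 where "f2 z = y * (c * z$2 + a * pot2 z) + x * (c * z$3 + a * pot3 e z)" for z
  have f2: "(f2 has_derivative (\<lambda>h. y * (c * h$2 + a * (pot12 z * h$1 + tan1 z * h$3))
      + x * (c * h$3 + a * (pot13 e z * h$1 + tan1 z * h$2 + pot33 e z * h$3)))) (at z)"
    if "z \<in> closed_cell \<rho>" for z
    unfolding f2_def[abs_def] using closed_cell_bounds(1)[OF that]
    by (intro has_derivative_add has_derivative_mult_right has_derivative_pot2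
        has_derivative_pot3 has_derivative_nth)
  have "f2 \<xi> = f2 \<xi>'" unfolding f2_def e2 e3 ..
  then obtain t' where t': "0 \<le> t'" "t' \<le> 1" and w: "\<xi>' + t' *\<^sub>R (\<xi> - \<xi>') \<in> closed_cell \<rho>"
    and crit2: "y * (c * dx + a * (pot12 (\<xi>' + t' *\<^sub>R (\<xi> - \<xi>')) * ds + tan1 (\<xi>' + t' *\<^sub>R (\<xi> - \<xi>')) * dy))
      + x * (c * dy + a * (pot13 e (\<xi>' + t' *\<^sub>R (\<xi> - \<xi>')) * ds + tan1 (\<xi>' + t' *\<^sub>R (\<xi> - \<xi>')) * dx
        + pot33 e (\<xi>' + t' *\<^sub>R (\<xi> - \<xi>')) * dy)) = 0"
    using has_derivative_critical_on_segment[OF convex_closed_cell cell f2]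
    unfolding ds_def dx_def dy_def by blast
  let ?w = "\<xi>' + t' *\<^sub>R (\<xi> - \<xi>')"
  have "ds = 0 \<or> N = 0"
  proof (rule weighted_estimate_2[OF c closed_cell_small[OF w e] N_def m_def _ _ est1])
    have wc: "?w$2 = x + t' * dx" "?w$3 = y + t' * dy" by (simp_all add: x_def y_def dx_def dy_def)
    define h where "h = pot13 e ?w - ?w$2 * (1 + (tan1 ?w)\<^sup>2)"
    have "\<bar>h\<bar> \<le> \<bar>?w$3\<bar> * \<rho>"
      unfolding h_def using pot13_approx[of ?w \<rho> e] closed_cell_bounds[OF w] e \<rho> by simp
    then have "N / 2 \<le> y * ((1 + (tan1 ?w)\<^sup>2) * (y + t' * dy)) + x * ((1 + (tan1 ?w)\<^sup>2) * (x + t' * dx) + h)"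
      unfolding wc using \<rho> by (intro mixed_estimate[OF N_def m_def small t']) auto
    also have "\<dots> = y * pot12 ?w + x * pot13 e ?w"
      by (simp only: h_def pot12_def wc) (simp add: algebra_simps)
    finally show "N / 2 \<le> y * pot12 ?w + x * pot13 e ?w" .
    show "a * ds * (y * pot12 ?w + x * pot13 e ?w) + c * (y * dx + x * dy) + a * tan1 ?w * (y * dy + x * dx) +
        a * pot33 e ?w * x * dy = 0"
      using crit2 by (simp add: algebra_simps)
  qed
  \<comment> \<open>In either case the right side of \<open>est1\<close> vanishes.\<close>
  then have "32 * c * m \<le> 0" using est1 by auto
  then have m: "m = 0" using c by (simp add: mult_le_0_iff m_def sum_power2_le_zero_iff)
  then have d: "dx = 0" "dy = 0" by (auto simp: m_def sum_power2_eq_zero_iff)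
  have "ds = 0"
  proof (cases "N = 0")
    case True
    then have "x = 0" "y = 0" by (auto simp: N_def sum_power2_eq_zero_iff)
    then have "tan1 \<xi> = tan1 \<xi>'"
      using d bs(2,8) \<rho> e(1) e1 by (intro pot1_axis_inj[of _ _ e]) (auto simp: x_def y_def dx_def dy_def)
    then have "\<xi>$1 = \<xi>'$1" using bs(5,11) by metis
    then show ?thesis by (simp add: ds_def)
  qed (use \<open>ds = 0 \<or> N = 0\<close> in simp)
  then show "\<xi> = \<xi>'" using d by (simp add: vec_eq_iff forall_3 ds_def dx_def dy_def)
qed

end

section \<open>The rotated graph\<close>

lemma continuous_on_nth_imp:
  fixes f :: "'a::topological_space \<Rightarrow> real^'n"
  assumes "\<And>i. continuous_on S (\<lambda>x. f x $ i)"
  shows "continuous_on S f"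
  using continuous_on_vec_lambda[of S "\<lambda>i x. f x $ i"] assms by simp

lemma pot_zero: "pot1 e 0 = 0" "pot2 0 = 0" "pot3 e 0 = 0"
  by (simp_all add: pot1_def pot2_def pot3_def tan1_def)

lemma base_zero: "base a c e 0 = 0"
  by (simp add: vec_eq_iff forall_3 base_nth pot_zero)

lemma continuous_on_base: "continuous_on (closed_cell \<rho>) (base a c e)"
proof (rule continuous_on_nth_imp)
  have cos: "cos (\<xi>$1) \<noteq> 0" if "\<xi> \<in> closed_cell \<rho>" for \<xi> using closed_cell_bounds(1)[OF that] .
  have p: "continuous_on (closed_cell \<rho>) (pot1 e)" "continuous_on (closed_cell \<rho>) pot2" "continuous_on (closed_cell \<rho>) (pot3 e)"
    using has_derivative_continuous[OF has_derivative_pot1[OF cos]]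
      has_derivative_continuous[OF has_derivative_pot2[OF cos]]
      has_derivative_continuous[OF has_derivative_pot3[OF cos]]
    by (simp_all add: continuous_at_imp_continuous_on)
  show "continuous_on (closed_cell \<rho>) (\<lambda>x. base a c e x $ i)" for i
  proof -
    consider "i = 1" | "i = 2" | "i = 3" using exhaust_3 by blast
    then show ?thesis
      by cases (simp only: base_nth, intro continuous_intros p continuous_on_component)+
  qed
qed

text \<open>The map is affine in \<open>e\<close>; the coefficient of \<open>e\<close> is at most 3,
  0 and 1 in the three components.\<close>

lemma base_perturb:
  assumes "\<bar>tan1 \<xi>\<bar> \<le> 1" "\<bar>\<xi>$3\<bar> \<le> 1" "0 \<le> e" "\<bar>a\<bar> \<le> 1"
  shows "norm (base a c e \<xi> - base a c 0 \<xi>) \<le> 4 * e"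
proof -
  define s w q y where "s = tan1 \<xi>" and "w = s\<^sup>2" and "q = cossq1 \<xi>" and "y = \<xi>$3"
  have s: "\<bar>s\<bar> \<le> 1" "0 \<le> w" "w \<le> 1" using assms(1) by (simp_all add: s_def w_def abs_square_le_1)
  have y: "\<bar>y\<bar> \<le> 1" "0 \<le> y\<^sup>2" "y\<^sup>2 \<le> 1" using assms(2) by (simp_all add: y_def abs_square_le_1)
  have q: "0 < q" "q \<le> 1" using cossq1_bounds by (simp_all add: q_def)
  have yw: "0 \<le> y\<^sup>2 * (1 + w)" "y\<^sup>2 * (1 + w) \<le> 1 * 2" using mult_mono[of "y\<^sup>2" 1 "1 + w" 2] s y by simp_all
  have "(base a c e \<xi> - base a c 0 \<xi>) $ 1 = e * (s * (y\<^sup>2 * (1 + w) + q))"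
    by (simp add: base_nth pot1_def s_def w_def q_def y_def algebra_simps)
  moreover have "\<bar>s * (y\<^sup>2 * (1 + w) + q)\<bar> \<le> 1 * 3"
    unfolding abs_mult using s q yw by (intro mult_mono) auto
  ultimately have 1: "\<bar>(base a c e \<xi> - base a c 0 \<xi>) $ 1\<bar> \<le> e * 3"
    using assms(3) by (simp add: abs_mult mult_left_mono)
  have 2: "(base a c e \<xi> - base a c 0 \<xi>) $ 2 = 0" by (simp add: base_nth)
  have "(base a c e \<xi> - base a c 0 \<xi>) $ 3 = e * (a * (y * (1 - w)))"
    by (simp add: base_nth pot3_def s_def w_def q_def y_def algebra_simps)
  moreover have "\<bar>y * (1 - w)\<bar> \<le> 1 * 1" unfolding abs_mult using s y by (intro mult_mono) auto
  then have "\<bar>a * (y * (1 - w))\<bar> \<le> 1 * 1" unfolding abs_mult[of a] using assms(4) by (intro mult_mono) auto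
  ultimately have 3: "\<bar>(base a c e \<xi> - base a c 0 \<xi>) $ 3\<bar> \<le> e * 1"
    using assms(3) by (simp only: abs_mult[of e] abs_of_nonneg mult_left_mono)
  show ?thesis
    using norm_le_l1_cart[of "base a c e \<xi> - base a c 0 \<xi>"] 1 2 3 unfolding sum_3 by linarith
qed

definition jac_fibre :: "real \<Rightarrow> real \<Rightarrow> real \<Rightarrow> real^3 \<Rightarrow> real^3^3" where
  "jac_fibre a c e \<xi> = vector
    [vector [1, 0, 0],
     vector [c * pot12 \<xi>, - a, c * tan1 \<xi>],
     vector [c * pot13 e \<xi>, c * tan1 \<xi>, - a + c * pot33 e \<xi>]]"

definition fibre :: "real \<Rightarrow> real \<Rightarrow> real \<Rightarrow> real^3 \<Rightarrow> real^3" where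
  "fibre a c e \<xi> = vector [\<xi>$1, - a * \<xi>$2 + c * pot2 \<xi>, - a * \<xi>$3 + c * pot3 e \<xi>]"

text \<open>A potential on the graph for the one-form given by the sum of \<open>fibre $ i\<close>
  times the differential of \<open>base $ i\<close>. The first coordinate contributes a Legendre
  transform up to sign, the other two the quadratic terms of a rotation by \<alpha>.\<close>

definition primitive :: "real \<Rightarrow> real \<Rightarrow> real \<Rightarrow> real^3 \<Rightarrow> real" where
  "primitive a c e \<xi> = pot e \<xi> - \<xi>$1 * pot1 e \<xi>
    - a * c / 2 * ((\<xi>$2)\<^sup>2 - (pot2 \<xi>)\<^sup>2 + (\<xi>$3)\<^sup>2 - (pot3 e \<xi>)\<^sup>2)
    - a\<^sup>2 * (\<xi>$2 * pot2 \<xi> + \<xi>$3 * pot3 e \<xi>)"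

lemma fibre_nth:
  "fibre a c e \<xi> $ 1 = \<xi>$1"
  "fibre a c e \<xi> $ 2 = - a * \<xi>$2 + c * pot2 \<xi>"
  "fibre a c e \<xi> $ 3 = - a * \<xi>$3 + c * pot3 e \<xi>"
  by (simp_all add: fibre_def vector_3)

lemma has_derivative_base:
  assumes "cos (\<xi>$1) \<noteq> 0"
  shows "((\<lambda>\<xi>. base a c e \<xi> $ i) has_derivative (\<lambda>h. (jac_base a c e \<xi> *v h) $ i)) (at \<xi>)"
proof -
  note d = has_derivative_pot1[OF assms] has_derivative_pot2[OF assms] has_derivative_pot3[OF assms]
    has_derivative_nth
  consider "i = 1" | "i = 2" | "i = 3" using exhaust_3 by blast
  then show ?thesis
  proof cases
    case 1 show ?thesis unfolding 1 base_nth
      by (rule has_derivative_eq_rhs, (rule derivative_intros d)+, rule ext)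
        (simp add: matrix_vector_mult_def sum_3 jac_base_def jac_fibre_def vector_3)
  next
    case 2 show ?thesis unfolding 2 base_nth
      by (rule has_derivative_eq_rhs, (rule derivative_intros d)+, rule ext)
        (simp add: matrix_vector_mult_def sum_3 jac_base_def jac_fibre_def vector_3 algebra_simps)
  next
    case 3 show ?thesis unfolding 3 base_nth
      by (rule has_derivative_eq_rhs, (rule derivative_intros d)+, rule ext)
        (simp add: matrix_vector_mult_def sum_3 jac_base_def jac_fibre_def vector_3 algebra_simps)
  qed
qed

lemma has_derivative_fibre:
  assumes "cos (\<xi>$1) \<noteq> 0"
  shows "((\<lambda>\<xi>. fibre a c e \<xi> $ i) has_derivative (\<lambda>h. (jac_fibre a c e \<xi> *v h) $ i)) (at \<xi>)"
proof -
  note d = has_derivative_pot2[OF assms] has_derivative_pot3[OF assms] has_derivative_nth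
  consider "i = 1" | "i = 2" | "i = 3" using exhaust_3 by blast
  then show ?thesis
  proof cases
    case 1 show ?thesis unfolding 1 fibre_nth
      by (rule has_derivative_eq_rhs, (rule derivative_intros d)+, rule ext)
        (simp add: matrix_vector_mult_def sum_3 jac_base_def jac_fibre_def vector_3)
  next
    case 2 show ?thesis unfolding 2 fibre_nth
      by (rule has_derivative_eq_rhs, (rule derivative_intros d)+, rule ext)
        (simp add: matrix_vector_mult_def sum_3 jac_base_def jac_fibre_def vector_3 algebra_simps)
  next
    case 3 show ?thesis unfolding 3 fibre_nth
      by (rule has_derivative_eq_rhs, (rule derivative_intros d)+, rule ext)
        (simp add: matrix_vector_mult_def sum_3 jac_base_def jac_fibre_def vector_3 algebra_simps)
  qed
qed

lemma has_derivative_primitive: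
  assumes "cos (\<xi>$1) \<noteq> 0" "a\<^sup>2 + c\<^sup>2 = 1"
  shows "(primitive a c e has_derivative (\<lambda>h. fibre a c e \<xi> \<bullet> (jac_base a c e \<xi> *v h))) (at \<xi>)"
proof -
  note d = has_derivative_pot[OF assms(1)] has_derivative_pot1[OF assms(1)] has_derivative_pot2[OF assms(1)]
    has_derivative_pot3[OF assms(1)] has_derivative_nth
  have c2: "c * c = 1 - a * a" using assms(2) by (simp add: power2_eq_square algebra_simps)
  have c2': "c * (c * t) = t - a * (a * t)" for t
    using c2 by (simp add: mult.assoc[symmetric] left_diff_distrib)
  show ?thesis
    unfolding primitive_def[abs_def]
    by (rule has_derivative_eq_rhs, (rule derivative_intros d)+, rule ext)
      (simp add: matrix_vector_mult_def inner_vec_def sum_3 jac_base_def jac_fibre_def vector_3 fibre_nth power2_eq_square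
        algebra_simps c2 c2')
qed

text \<open>The tangent spaces of a gradient graph are Lagrangian, and the rotation preserves this.
  The symmetry of the Hessian of the solution is derived from here.\<close>

lemma jac_lagrangian:
  assumes "a\<^sup>2 + c\<^sup>2 = 1"
  shows "transpose (jac_fibre a c e \<xi>) ** jac_base a c e \<xi> = transpose (jac_base a c e \<xi>) ** jac_fibre a c e \<xi>"
proof -
  have c2: "c * c = 1 - a * a" using assms(1) by (simp add: power2_eq_square algebra_simps)
  have c2': "c * (c * t) = t - a * (a * t)" for t
    using c2 by (simp add: mult.assoc[symmetric] left_diff_distrib)
  show ?thesis
    by (simp add: vec_eq_iff forall_3 matrix_matrix_mult_def transpose_def sum_3 jac_base_def jac_fibre_def vector_3
        algebra_simps c2 c2')
qed

text \<open>For \<open>k\<^sup>2 = 1\<close> the matrix is \<open>diag (k\<i>, c - k\<i>a, c - k\<i>a)\<close> times \<open>I + k\<i>V\<close>, where \<open>det (I + k\<i>V) = D\<close>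
  because \<open>tr V = det V\<close>.\<close>

lemma det_complex_jac:
  fixes a c e k :: real and \<xi> :: "real^3"
  defines "D \<equiv> 1 - pot11 e \<xi> * pot33 e \<xi> + (pot12 \<xi>)\<^sup>2 + (pot13 e \<xi>)\<^sup>2 + (tan1 \<xi>)\<^sup>2"
  assumes k: "k = 1 \<or> k = - 1"
  shows "det (\<chi> i j. complex_of_real (jac_base a c e \<xi> $ i $ j) + \<i> * of_real k * of_real (jac_fibre a c e \<xi> $ i $ j))
    = of_real k * \<i> * (of_real c - \<i> * of_real k * of_real a)\<^sup>2 * of_real D"
proof -
  define s p q r v where "s = complex_of_real (tan1 \<xi>)" and "p = complex_of_real (pot12 \<xi>)"
    and "q = complex_of_real (pot13 e \<xi>)" and "r = complex_of_real (pot33 e \<xi>)" and "v = complex_of_real (pot11 e \<xi>)"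
  define A C K where "A = complex_of_real a" and "C = complex_of_real c" and "K = complex_of_real k"
  note defs = s_def p_def q_def r_def v_def A_def C_def K_def
  have pde: "v + r = 2 * p * q * s - p\<^sup>2 * r - s\<^sup>2 * v"
    using arg_cong[OF pot_special_lagrangian[of e \<xi>], of complex_of_real] by (simp add: defs)
  have K: "K\<^sup>2 = 1" and i: "\<i>\<^sup>2 = - 1" using k by (auto simp: K_def)
  have "det (\<chi> i j. complex_of_real (jac_base a c e \<xi> $ i $ j) + \<i> * of_real k * of_real (jac_fibre a c e \<xi> $ i $ j))
    = (- v + \<i> * K) * ((C + \<i> * K * - A) * (C + A * r + \<i> * K * (- A + C * r)) - (A * s + \<i> * K * (C * s))\<^sup>2)
      + p * ((A * p + \<i> * K * (C * p)) * (C + A * r + \<i> * K * (- A + C * r)) - (A * s + \<i> * K * (C * s)) * (A * q + \<i> * K * (C * q)))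
      - q * ((A * p + \<i> * K * (C * p)) * (A * s + \<i> * K * (C * s)) - (C + \<i> * K * - A) * (A * q + \<i> * K * (C * q)))"
    by (simp add: det_3 jac_base_def jac_fibre_def vector_3 defs algebra_simps power2_eq_square)
  also have "\<dots> = K * \<i> * (C - \<i> * K * A)\<^sup>2 * (1 - v * r + p\<^sup>2 + q\<^sup>2 + s\<^sup>2)"
    using pde K i by algebra
  finally show ?thesis by (simp add: D_def defs)
qed

text \<open>Multiplying by \<open>1 + (tan1 \<xi>)\<^sup>2\<close> allows us to eliminate \<open>pot11\<close>, for which no lower bound is available,
  by means of the equation.\<close>

lemma phase_modulus_pos:
  assumes "\<bar>tan1 \<xi>\<bar> \<le> 1" "\<bar>pot33 e \<xi>\<bar> \<le> 1"
  shows "1 - pot11 e \<xi> * pot33 e \<xi> + (pot12 \<xi>)\<^sup>2 + (pot13 e \<xi>)\<^sup>2 + (tan1 \<xi>)\<^sup>2 > 0"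
proof -
  define s p q r v where "s = tan1 \<xi>" and "p = pot12 \<xi>" and "q = pot13 e \<xi>" and "r = pot33 e \<xi>" and "v = pot11 e \<xi>"
  have pde: "v * (1 + s\<^sup>2) = 2 * p * q * s - p\<^sup>2 * r - r"
    using pot_special_lagrangian[of e \<xi>] by (simp add: s_def p_def q_def r_def v_def algebra_simps)
  have "(1 - v * r + p\<^sup>2 + q\<^sup>2 + s\<^sup>2) * (1 + s\<^sup>2) = (1 + s\<^sup>2) * (1 + s\<^sup>2) + s\<^sup>2 * (p\<^sup>2 + q\<^sup>2) + r\<^sup>2 * (1 + p\<^sup>2)
      + (p\<^sup>2 + q\<^sup>2 - (2 * p * q) * (s * r))"
    using pde by algebra
  \<comment> \<open>The only term of unknown sign is dominated by \<open>p^2 + q^2\<close> because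
    \<open>\<bar>s * r\<bar> \<le> 1\<close>.\<close>
  moreover have "\<bar>(2 * p * q) * (s * r)\<bar> \<le> (p\<^sup>2 + q\<^sup>2) * 1"
    unfolding abs_mult[of "2 * p * q"]
  proof (rule mult_mono)
    show "\<bar>2 * p * q\<bar> \<le> p\<^sup>2 + q\<^sup>2"
      using sum_squares_bound[of "\<bar>p\<bar>" "\<bar>q\<bar>"] by (simp add: abs_mult)
    show "\<bar>s * r\<bar> \<le> 1" unfolding abs_mult using assms by (intro mult_le_one) (auto simp: s_def r_def)
  qed auto
  then have "p\<^sup>2 + q\<^sup>2 - (2 * p * q) * (s * r) \<ge> 0" by (simp add: abs_le_iff)
  moreover have "(1 + s\<^sup>2) * (1 + s\<^sup>2) > 0" by (simp add: add_pos_nonneg)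
  moreover have "s\<^sup>2 * (p\<^sup>2 + q\<^sup>2) \<ge> 0" "r\<^sup>2 * (1 + p\<^sup>2) \<ge> 0" by simp_all
  ultimately have "(1 - v * r + p\<^sup>2 + q\<^sup>2 + s\<^sup>2) * (1 + s\<^sup>2) > 0" by linarith
  moreover have "1 + s\<^sup>2 > 0" by (simp add: add_pos_nonneg)
  ultimately show ?thesis
    unfolding s_def[symmetric] p_def[symmetric] q_def[symmetric] r_def[symmetric] v_def[symmetric]
    by (simp add: zero_less_mult_iff)
qed

text \<open>Injectivity at \<open>e = 0\<close> keeps the image of the boundary of the cell away from \<open>0\<close>, uniformly in small \<open>e\<close>. A
  ball that avoids this image meets the image of the open cell in a clopen subset.\<close>

lemma (in small_cell) uniform_ball:
  obtains R e0 where "R > 0" "e0 > 0" "e0 \<le> \<rho>"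
    "\<And>e. 0 < e \<Longrightarrow> e \<le> e0 \<Longrightarrow> ball 0 R \<subseteq> base a c e ` open_cell \<rho>"
proof -
  define B where "B = closed_cell \<rho> - open_cell \<rho>"
  have "compact B" unfolding B_def by (rule compact_diff[OF compact_closed_cell open_open_cell])
  then have "compact (base a c 0 ` B)"
    using continuous_on_subset[OF continuous_on_base, of B] by (intro compact_continuous_image) (auto simp: B_def)
  moreover have "0 \<notin> base a c 0 ` B"
  proof
    assume "0 \<in> base a c 0 ` B"
    then obtain \<xi> where \<xi>: "\<xi> \<in> closed_cell \<rho>" "\<xi> \<notin> open_cell \<rho>" "base a c 0 \<xi> = base a c 0 0"
      by (auto simp: B_def base_zero)
    have "0 \<in> closed_cell \<rho>" using zero_in_open_cell[OF \<rho>(1)] open_cell_subset by blast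
    then have "\<xi> = 0" using inj_onD[OF inj_on_base \<xi>(3) \<xi>(1)] \<rho> by simp
    then show False using \<xi>(2) zero_in_open_cell[OF \<rho>(1)] by simp
  qed
  ultimately obtain d where d: "d > 0" "\<And>\<xi>. \<xi> \<in> B \<Longrightarrow> d \<le> dist 0 (base a c 0 \<xi>)"
    using separate_point_closed[of "base a c 0 ` B" 0] compact_imp_closed by blast
  \<comment> \<open>For \<open>e \<le> d / 16\<close> the map moves by at most
    \<open>4 * e \<le> d / 4\<close>, so the image of \<open>B\<close> stays outside the ball of
    radius \<open>d / 2\<close>.\<close>
  show ?thesis
  proof (rule that[of "d / 2" "min \<rho> (d / 16)"])
    fix e assume e: "0 < e" "e \<le> min \<rho> (d / 16)"
    have far: "base a c e \<xi> \<notin> ball 0 (d / 2)" if "\<xi> \<in> B" for \<xi>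
    proof -
      have \<xi>: "\<xi> \<in> closed_cell \<rho>" using that by (simp add: B_def)
      have "norm (base a c e \<xi> - base a c 0 \<xi>) \<le> 4 * e"
        using closed_cell_bounds[OF \<xi>] e \<rho> a c by (intro base_perturb) auto
      moreover have "norm (base a c 0 \<xi>) \<ge> d" using d(2)[OF that] by simp
      moreover have "norm (base a c 0 \<xi>) \<le> norm (base a c e \<xi>) + norm (base a c e \<xi> - base a c 0 \<xi>)"
        using norm_triangle_sub[of "base a c 0 \<xi>" "base a c e \<xi>"] by (simp add: norm_minus_commute)
      ultimately show ?thesis using e d(1) by simp
    qed
    have "inj_on (base a c e) (closed_cell \<rho>)" using e by (intro inj_on_base) auto
    then have "open (base a c e ` open_cell \<rho>)"
      by (intro invariance_of_domain[OF _ open_open_cell] continuous_on_subset[OF continuous_on_base open_cell_subset]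
          inj_on_subset[OF _ open_cell_subset])
    then have 1: "openin (top_of_set (ball 0 (d / 2))) (ball 0 (d / 2) \<inter> base a c e ` open_cell \<rho>)"
      by (rule openin_open_Int)
    have "closed (base a c e ` closed_cell \<rho>)"
      by (rule compact_imp_closed[OF compact_continuous_image[OF continuous_on_base compact_closed_cell]])
    then have "closedin (top_of_set (ball 0 (d / 2))) (ball 0 (d / 2) \<inter> base a c e ` closed_cell \<rho>)"
      by (rule closedin_closed_Int)
    moreover have "ball 0 (d / 2) \<inter> base a c e ` closed_cell \<rho> = ball 0 (d / 2) \<inter> base a c e ` open_cell \<rho>"
    proof -
      have "closed_cell \<rho> = open_cell \<rho> \<union> B" using open_cell_subset by (auto simp: B_def)
      then show ?thesis using far by auto
    qed
    ultimately have 2: "closedin (top_of_set (ball 0 (d / 2))) (ball 0 (d / 2) \<inter> base a c e ` open_cell \<rho>)"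
      by simp
    have "0 = base a c e 0" by (simp add: base_zero)
    then have "0 \<in> base a c e ` open_cell \<rho>" using zero_in_open_cell[OF \<rho>(1)] by (rule image_eqI)
    then have "0 \<in> ball 0 (d / 2) \<inter> base a c e ` open_cell \<rho>" using d(1) by simp
    then have "ball 0 (d / 2) \<inter> base a c e ` open_cell \<rho> = ball 0 (d / 2)"
      using connected_ball[of "0::real^3" "d / 2"] 1 2 unfolding connected_clopen by blast
    then show "ball 0 (d / 2) \<subseteq> base a c e ` open_cell \<rho>" by blast
  qed (use d(1) \<rho>(1) in auto)
qed

lemma matrix_axis_nth: "(A *v axis j 1) $ i = A $ i $ j"
  by (simp add: matrix_vector_mult_def axis_def if_distrib cong: if_cong)

text \<open>A crude bound (the components are at most 1, 2 and 4) that does not depend on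
  \<open>e\<close>; it becomes the uniform gradient bound.\<close>

lemma fibre_bound:
  assumes "\<bar>tan1 \<xi>\<bar> \<le> 1" "\<bar>\<xi>$1\<bar> \<le> 1" "\<bar>\<xi>$2\<bar> \<le> 1" "\<bar>\<xi>$3\<bar> \<le> 1" "0 \<le> e" "e \<le> 1" "\<bar>a\<bar> \<le> 1" "\<bar>c\<bar> \<le> 1"
  shows "norm (fibre a c e \<xi>) \<le> 10"
proof -
  define s w q x y where "s = tan1 \<xi>" and "w = s\<^sup>2" and "q = cossq1 \<xi>" and "x = \<xi>$2" and "y = \<xi>$3"
  have s: "\<bar>s\<bar> \<le> 1" "0 \<le> w" "w \<le> 1" using assms(1) by (simp_all add: s_def w_def abs_square_le_1)
  have q: "0 < q" "q \<le> 1" using cossq1_bounds by (simp_all add: q_def)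
  have xy: "\<bar>x\<bar> \<le> 1" "\<bar>y\<bar> \<le> 1" using assms by (simp_all add: x_def y_def)
  have 2: "\<bar>pot2 \<xi>\<bar> \<le> 1"
    unfolding pot2_def abs_mult using assms by (intro mult_le_one) auto
  have xs: "\<bar>x * s\<bar> \<le> 1" unfolding abs_mult using s xy by (intro mult_le_one) auto
  have "\<bar>e * y\<bar> \<le> 1" unfolding abs_mult using assms xy by (intro mult_le_one) auto
  then have ey: "\<bar>e * y * (1 - w)\<bar> \<le> 1" unfolding abs_mult[of "e * y"] using s by (intro mult_le_one) auto
  have "\<bar>y ^ 3\<bar> \<le> 1" unfolding power_abs using xy by (intro power_le_one) auto
  moreover have "w\<^sup>2 \<le> 1" "0 \<le> w\<^sup>2" using s by (auto intro!: power_le_one)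
  then have "\<bar>1 - 6 * w + w\<^sup>2\<bar> \<le> 10" using s unfolding abs_le_iff by argo
  ultimately have "\<bar>(1 - 6 * w + w\<^sup>2) * y ^ 3\<bar> \<le> 10 * 1" unfolding abs_mult by (intro mult_mono) auto
  moreover have "\<bar>4 - 4 * q - w\<bar> \<le> 10" using s q unfolding abs_le_iff by argo
  then have "\<bar>(4 - 4 * q - w) * y\<bar> \<le> 10 * 1" unfolding abs_mult using xy by (intro mult_mono) auto
  ultimately have "\<bar>4 * ((1 - 6 * w + w\<^sup>2) * y ^ 3) - 4 * ((4 - 4 * q - w) * y)\<bar> \<le> 100"
    unfolding abs_le_iff by argo
  then have "\<bar>quartic_weight * (4 * ((1 - 6 * w + w\<^sup>2) * y ^ 3) - 4 * ((4 - 4 * q - w) * y))\<bar> \<le> 1"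
    unfolding abs_mult[of quartic_weight] by (simp add: quartic_weight_def)
  moreover have "pot3 e \<xi> = x * s + e * y * (1 - w) - quartic_weight * (4 * ((1 - 6 * w + w\<^sup>2) * y ^ 3) - 4 * ((4 - 4 * q - w) * y))"
    by (simp add: pot3_def s_def w_def q_def x_def y_def algebra_simps)
  ultimately have 3: "\<bar>pot3 e \<xi>\<bar> \<le> 3" using xs ey unfolding abs_le_iff by argo
  have "\<bar>a * x\<bar> \<le> 1" "\<bar>a * y\<bar> \<le> 1" unfolding abs_mult using assms xy by (auto intro!: mult_le_one)
  moreover have "\<bar>c * pot2 \<xi>\<bar> \<le> 1 * 1" "\<bar>c * pot3 e \<xi>\<bar> \<le> 1 * 3"
    unfolding abs_mult using assms 2 3 by (intro mult_mono; auto)+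
  ultimately have "\<bar>fibre a c e \<xi> $ 2\<bar> \<le> 2" "\<bar>fibre a c e \<xi> $ 3\<bar> \<le> 4" "\<bar>fibre a c e \<xi> $ 1\<bar> \<le> 1"
    using assms(2) unfolding fibre_nth x_def y_def by simp_all
  then show ?thesis
    using norm_le_l1_cart[of "fibre a c e \<xi>"] unfolding sum_3 by linarith
qed

section \<open>From a Lagrangian pair of matrices to the phase\<close>

lemma transpose_conj_cancel:
  fixes A B M :: "real^'n^'n"
  assumes "det M \<noteq> 0" and eq: "transpose M ** A ** M = transpose M ** B ** M"
  shows "A = B"
proof -
  obtain N where N: "M ** N = mat 1"
    using assms(1) invertible_det_nz[of M] unfolding invertible_def by blast
  then have N': "transpose N ** transpose M = mat 1"
    by (metis matrix_transpose_mul transpose_mat)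
  have "X = transpose N ** (transpose M ** X ** M) ** N" for X
  proof -
    have "transpose N ** (transpose M ** X ** M) ** N = (transpose N ** transpose M) ** X ** (M ** N)"
      by (simp only: matrix_mul_assoc)
    then show ?thesis by (simp add: N N')
  qed
  then show ?thesis using eq by metis
qed

text \<open>The Lagrangian condition makes \<open>transpose M ** transpose H ** M\<close> symmetric,
  hence \<open>H\<close> symmetric. Then \<open>(I + \<i>H) M = M + \<i>kL\<close>, and dividing
  determinants by \<open>det M > 0\<close> gives \<open>det (I + \<i>H)\<close> the argument
  \<Theta>.\<close>

lemma sum_arctan_lagrangian_pair:
  fixes H M L :: "real^3^3"
  assumes HM: "transpose H ** M = k *\<^sub>R L"
    and lagr: "transpose L ** M = transpose M ** L"
    and det: "0 < det M"
    and phase: "det (\<chi> i j. complex_of_real (M $ i $ j) + \<i> * of_real k * of_real (L $ i $ j)) = cis \<Theta> * of_real D"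
    and D: "0 < D" and \<Theta>: "\<bar>\<Theta>\<bar> < pi / 2"
  shows "(\<Sum>\<mu>\<in>#eigenvalues H. arctan \<mu>) = \<Theta>"
proof (rule sum_arctan_eigenvalues[OF _ _ _ \<Theta>])
  have "transpose M ** transpose H ** M = transpose M ** (k *\<^sub>R L)"
    by (simp only: matrix_mul_assoc[symmetric] HM)
  also have "\<dots> = k *\<^sub>R (transpose M ** L)"
    by (simp add: matrix_scalar_ac scalar_matrix_assoc)
  finally have "transpose M ** transpose H ** M = k *\<^sub>R (transpose M ** L)" .
  moreover have "transpose M ** H ** M = transpose (transpose M ** transpose H ** M)"
    by (simp add: matrix_transpose_mul matrix_mul_assoc)
  moreover have "transpose (k *\<^sub>R (transpose M ** L)) = k *\<^sub>R (transpose M ** L)"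
    by (simp add: transpose_scalar matrix_transpose_mul lagr)
  ultimately have "transpose M ** transpose H ** M = transpose M ** H ** M" by simp
  then show sym: "transpose H = H" by (rule transpose_conj_cancel[OF less_imp_neq[OF det, symmetric]])
  show "0 < D / det M" using D det by simp
  define CM I where "CM = (\<chi> i j. complex_of_real (M $ i $ j))"
    and "I = (\<chi> i j. (if i = j then 1 else 0) + \<i> * complex_of_real (H $ i $ j))"
  have HM': "(\<Sum>l\<in>UNIV. H $ i $ l * M $ l $ j) = k * L $ i $ j" for i j
  proof -
    have "(H ** M) $ i $ j = (k *\<^sub>R L) $ i $ j" using HM unfolding sym by simp
    then show ?thesis by (simp add: matrix_matrix_mult_def)
  qed
  have "I ** CM = (\<chi> i j. complex_of_real (M $ i $ j) + \<i> * of_real k * of_real (L $ i $ j))"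
  proof -
    have "(I ** CM) $ i $ j = complex_of_real (M $ i $ j) + \<i> * of_real k * of_real (L $ i $ j)" for i j
    proof -
      have "(I ** CM) $ i $ j = (\<Sum>l\<in>UNIV. (if i = l then complex_of_real (M $ l $ j) else 0))
          + (\<Sum>l\<in>UNIV. \<i> * complex_of_real (H $ i $ l * M $ l $ j))"
        unfolding matrix_matrix_mult_def I_def CM_def sum.distrib[symmetric]
        by (simp add: distrib_right) (rule sum.cong; simp)
      also have "\<dots> = complex_of_real (M $ i $ j) + \<i> * of_real (\<Sum>l\<in>UNIV. H $ i $ l * M $ l $ j)"
        by (simp add: sum_distrib_left)
      finally show ?thesis unfolding HM' by simp
    qed
    then show ?thesis by (simp add: vec_eq_iff)
  qed
  then have "det I * det CM = cis \<Theta> * of_real D" using phase by (simp add: det_mul[symmetric])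
  moreover have "det CM = of_real (det M)" by (simp add: CM_def det_3)
  ultimately have "det I = of_real (D / det M) * cis \<Theta>"
    using det by (simp add: field_simps)
  then show "det (\<chi> i j. (if i = j then 1 else 0) + \<i> * complex_of_real (H $ i $ j)) =
      of_real (D / det M) * cis \<Theta>"
    by (simp add: I_def)
qed

section \<open>The solution in the rotated coordinates\<close>

definition chart_map :: "real \<Rightarrow> real \<Rightarrow> real \<Rightarrow> real \<Rightarrow> real^3 \<Rightarrow> real^3" where
  "chart_map a c R e \<xi> = (1 / R) *\<^sub>R base a c e \<xi>"

text \<open>Base coordinates scale by \<open>1 / R\<close>, so the factor \<open>1 / R^2\<close>
  scales the gradient by \<open>1 / R\<close> and leaves the Hessian, and with it the phase,
  unchanged.\<close>

definition solution :: "real \<Rightarrow> real \<Rightarrow> real \<Rightarrow> real \<Rightarrow> real \<Rightarrow> real \<Rightarrow> real^3 \<Rightarrow> real" where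
  "solution a c \<rho> k R e = (\<lambda>\<xi>. k / R\<^sup>2 * primitive a c e \<xi>) \<circ> chart.inv_chart (open_cell \<rho>) (chart_map a c R e)"

text \<open>The sign \<open>k = - 1\<close> covers \<open>\<Theta> > 0\<close>, and the factor \<open>1 / R\<close> rescales the uniform ball to the unit ball.\<close>

locale rotated_graph = small_cell +
  fixes k R e \<Theta> :: real
  assumes ac: "a\<^sup>2 + c\<^sup>2 = 1" and k: "k = 1 \<or> k = - 1" and R: "R > 0" and e: "0 < e" "e \<le> \<rho>"
    and R_ball: "ball 0 R \<subseteq> base a c e ` open_cell \<rho>"
    and phase: "of_real k * \<i> * (of_real c - \<i> * of_real k * of_real a)\<^sup>2 = cis \<Theta>"
    and \<Theta>: "\<bar>\<Theta>\<bar> < pi / 2"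
begin

abbreviation "F \<equiv> chart_map a c R e"

lemma open_cell_bounds: "\<xi> \<in> open_cell \<rho> \<Longrightarrow> \<xi> \<in> closed_cell \<rho>" "\<xi> \<in> open_cell \<rho> \<Longrightarrow> cos (\<xi>$1) \<noteq> 0"
  using open_cell_subset[of \<rho>] closed_cell_bounds(1) by blast+

lemma jacobi_matrix_F:
  assumes "\<xi> \<in> open_cell \<rho>"
  shows "jacobi_matrix F \<xi> = (1 / R) *\<^sub>R jac_base a c e \<xi>"
proof -
  have "((\<lambda>y. F y $ i) has_derivative (\<lambda>h. (1 / R) * (jac_base a c e \<xi> *v h) $ i)) (at \<xi>)" for i
    unfolding chart_map_def vector_scaleR_component real_scaleR_def
    by (rule has_derivative_mult_right[OF has_derivative_base[OF open_cell_bounds(2)[OF assms]]])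
  from partial_deriv_eq[OF this] show ?thesis
    by (simp add: vec_eq_iff jacobi_matrix_nth matrix_axis_nth)
qed

sublocale chart "open_cell \<rho>" F
proof
  show "open (open_cell \<rho>)" by (rule open_open_cell)
  have "inj_on (base a c e) (open_cell \<rho>)"
    using inj_on_subset[OF inj_on_base open_cell_subset] e by simp
  then show "inj_on F (open_cell \<rho>)" using R by (auto simp: inj_on_def chart_map_def)
  show "smooth_on (open_cell \<rho>) (\<lambda>x. F x $ i)" for i
  proof -
    have "smooth_on (open_cell \<rho>) (\<lambda>x. base a c e x $ i)"
    proof -
      note sm = smooth_on_pot1[OF open_open_cell open_cell_bounds(2)] smooth_on_pot2[OF open_open_cell open_cell_bounds(2)]
        smooth_on_pot3[OF open_open_cell open_cell_bounds(2)]
      consider "i = 1" | "i = 2" | "i = 3" using exhaust_3 by blast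
      then show ?thesis
        by cases (simp only: base_nth, intro smooth_on_minus smooth_on_add smooth_on_mult smooth_on_const
            smooth_on_nth open_open_cell sm; assumption)+
    qed
    then show ?thesis
      unfolding chart_map_def vector_scaleR_component real_scaleR_def
      by (intro smooth_on_mult smooth_on_const open_open_cell)
  qed
  fix \<xi> assume \<xi>: "\<xi> \<in> open_cell \<rho>"
  have "det ((1 / R) *\<^sub>R jac_base a c e \<xi>) = (1 / R)^3 * det (jac_base a c e \<xi>)"
    by (simp add: det_3 power3_eq_cube algebra_simps)
  then show "det (jacobi_matrix F \<xi>) \<noteq> 0"
    using det_jac_base_pos[OF open_cell_bounds(1)[OF \<xi>] e] R by (simp add: jacobi_matrix_F[OF \<xi>])
qed

abbreviation "u \<equiv> solution a c \<rho> k R e"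

lemma ball_subset: "ball 0 1 \<subseteq> F ` open_cell \<rho>"
proof
  fix x :: "real^3" assume "x \<in> ball 0 1"
  then have "R *\<^sub>R x \<in> ball 0 R" using R by simp
  then obtain \<xi> where \<xi>: "\<xi> \<in> open_cell \<rho>" "R *\<^sub>R x = base a c e \<xi>" using R_ball by blast
  then have "F \<xi> = x" using R by (simp add: chart_map_def flip: \<xi>(2))
  then show "x \<in> F ` open_cell \<rho>" using \<xi>(1) by blast
qed

lemma smooth_on_primitive_fibre:
  "smooth_on (open_cell \<rho>) (primitive a c e)" "smooth_on (open_cell \<rho>) (\<lambda>\<xi>. fibre a c e \<xi> $ j)"
proof -
  note sm = smooth_on_pot[OF open_open_cell open_cell_bounds(2)] smooth_on_pot1[OF open_open_cell open_cell_bounds(2)]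
    smooth_on_pot2[OF open_open_cell open_cell_bounds(2)] smooth_on_pot3[OF open_open_cell open_cell_bounds(2)]
  show "smooth_on (open_cell \<rho>) (primitive a c e)"
    unfolding primitive_def[abs_def]
    by (intro smooth_on_diff smooth_on_add smooth_on_mult smooth_on_power smooth_on_const
            smooth_on_nth open_open_cell sm; assumption)
  consider "j = 1" | "j = 2" | "j = 3" using exhaust_3 by blast
  then show "smooth_on (open_cell \<rho>) (\<lambda>\<xi>. fibre a c e \<xi> $ j)"
    by cases (simp only: fibre_nth, intro smooth_on_minus smooth_on_add smooth_on_mult smooth_on_const
        smooth_on_nth open_open_cell sm; assumption)+
qed

lemma smooth_on_primitive: "smooth_on (open_cell \<rho>) (\<lambda>\<xi>. k / R\<^sup>2 * primitive a c e \<xi>)"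
  by (intro smooth_on_mult smooth_on_const smooth_on_primitive_fibre open_open_cell)

lemma smooth_on_u: "smooth_on (F ` open_cell \<rho>) u"
  unfolding solution_def by (rule smooth_on_pullback[OF smooth_on_primitive])

text \<open>By \<open>has_derivative_primitive\<close> both sides have the same image under the
  transposed Jacobian matrix of the chart, which is invertible.\<close>

lemma gradient_u:
  assumes "\<xi> \<in> open_cell \<rho>"
  shows "gradient u (F \<xi>) = (k / R) *\<^sub>R fibre a c e \<xi>"
proof -
  let ?J = "transpose (jacobi_matrix F \<xi>)"
  have "((\<lambda>\<xi>. k / R\<^sup>2 * primitive a c e \<xi>) has_derivative (\<lambda>h. k / R\<^sup>2 * (fibre a c e \<xi> \<bullet> (jac_base a c e \<xi> *v h)))) (at \<xi>)"
    by (rule has_derivative_mult_right[OF has_derivative_primitive[OF open_cell_bounds(2)[OF assms] ac]])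
  from partial_deriv_eq[OF this]
  have "gradient (\<lambda>\<xi>. k / R\<^sup>2 * primitive a c e \<xi>) \<xi> $ j =
      k / R\<^sup>2 * (\<Sum>i\<in>UNIV. fibre a c e \<xi> $ i * jac_base a c e \<xi> $ i $ j)" for j
    by (simp add: gradient_def inner_vec_def matrix_axis_nth)
  then have "gradient (\<lambda>\<xi>. k / R\<^sup>2 * primitive a c e \<xi>) \<xi> = ?J *v ((k / R) *\<^sub>R fibre a c e \<xi>)"
    using R by (simp add: vec_eq_iff jacobi_matrix_F[OF assms] transpose_def matrix_vector_mult_def
        sum_3 power2_eq_square field_simps)
  then have eq: "?J *v gradient u (F \<xi>) = ?J *v ((k / R) *\<^sub>R fibre a c e \<xi>)"
    using gradient_pullback[OF smooth_on_primitive assms] unfolding solution_def by simp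
  have "invertible ?J" using det_nz[OF assms] by (simp add: invertible_det_nz)
  from injD[OF inj_matrix_vector_mult[OF this] eq] show ?thesis .
qed

text \<open>The components of the gradient are pullbacks of multiples of \<open>fibre\<close>, so
  \<open>gradient_pullback\<close> applies a second time. The transpose stands because the symmetry
  of the Hessian is only obtained afterwards, from this identity.\<close>

lemma hessian_u:
  assumes "\<xi> \<in> open_cell \<rho>"
  shows "transpose (hessian u (F \<xi>)) ** jac_base a c e \<xi> = k *\<^sub>R jac_fibre a c e \<xi>"
proof -
  define g where "g j \<xi> = k / R * fibre a c e \<xi> $ j" for j \<xi>
  have g: "smooth_on (open_cell \<rho>) (g j)" for j
    unfolding g_def[abs_def] by (intro smooth_on_mult smooth_on_const smooth_on_primitive_fibre open_open_cell)
  have "partial_deriv j u y = (g j \<circ> inv_chart) y" if "y \<in> F ` open_cell \<rho>" for j y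
  proof -
    from that obtain \<eta> where \<eta>: "\<eta> \<in> open_cell \<rho>" "y = F \<eta>" by blast
    have "gradient u y $ j = g j \<eta>" unfolding \<eta>(2) gradient_u[OF \<eta>(1)] by (simp add: g_def)
    then show ?thesis using inv_chart_F[OF \<eta>(1)] by (simp add: gradient_def \<eta>(2))
  qed
  then have H: "hessian u (F \<xi>) $ i $ j = gradient (g j \<circ> inv_chart) (F \<xi>) $ i" for i j
    using partial_deriv_cong[OF open_image, of "F \<xi>" "partial_deriv j u" "g j \<circ> inv_chart" i] assms
    by (simp add: hessian_def gradient_def)
  have dg: "(g j has_derivative (\<lambda>h. k / R * (jac_fibre a c e \<xi> *v h) $ j)) (at \<xi>)" for j
    unfolding g_def[abs_def]
    by (rule has_derivative_mult_right[OF has_derivative_fibre[OF open_cell_bounds(2)[OF assms]]])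
  have "(transpose (hessian u (F \<xi>)) ** jac_base a c e \<xi>) $ j $ l = (k *\<^sub>R jac_fibre a c e \<xi>) $ j $ l" for j l
  proof -
    have "(\<Sum>i\<in>UNIV. 1 / R * jac_base a c e \<xi> $ i $ l * hessian u (F \<xi>) $ i $ j) = k / R * jac_fibre a c e \<xi> $ j $ l"
      using arg_cong[OF gradient_pullback[OF g assms, of j], of "\<lambda>v. v $ l"]
      unfolding H[symmetric] jacobi_matrix_F[OF assms] matrix_vector_mult_def transpose_def
      by (simp add: H gradient_def partial_deriv_eq[OF dg] matrix_axis_nth)
    then show ?thesis using R
      by (simp add: matrix_matrix_mult_def transpose_def sum_3 field_simps)
  qed
  then show ?thesis by (simp add: vec_eq_iff)
qed

lemma special_lagrangian_u: "special_lagrangian \<Theta> (ball 0 1) u"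
  unfolding special_lagrangian_def
proof
  fix x :: "real^3" assume "x \<in> ball 0 1"
  then obtain \<xi> where \<xi>: "\<xi> \<in> open_cell \<rho>" "x = F \<xi>" using ball_subset by blast
  note b = closed_cell_bounds[OF open_cell_bounds(1)[OF \<xi>(1)]]
  have "\<bar>tan1 \<xi>\<bar> \<le> 1" "\<bar>pot33 e \<xi>\<bar> \<le> 1"
    using b \<rho> pot33_le[OF b(2,4), of e] e by auto
  note D = phase_modulus_pos[OF this]
  show "(\<Sum>\<mu>\<in>#eigenvalues (hessian u x). arctan \<mu>) = \<Theta>"
    unfolding \<xi>(2)
    by (rule sum_arctan_lagrangian_pair[OF hessian_u[OF \<xi>(1)] jac_lagrangian[OF ac] det_jac_base_pos[OF open_cell_bounds(1)[OF \<xi>(1)] e] _ D \<Theta>])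
      (simp only: det_complex_jac[OF k] phase)
qed

lemma Linfty_norm_u: "Linfty_norm (ball 0 1) (gradient u) \<le> ereal (10 / R)"
  unfolding Linfty_norm_def
proof (rule esssup_I)
  \<comment> \<open>Smoothness gives a continuous gradient and thereby the measurability that the
    essential supremum asks for.\<close>
  have "smooth_on (ball 0 1) u" by (rule smooth_on_subset[OF smooth_on_u ball_subset])
  then have "continuous_on (ball 0 1) (gradient u)"
    by (intro continuous_on_nth_imp) (simp add: gradient_def smooth_on_imp_continuous_on smooth_on_partial_deriv)
  then have "gradient u \<in> borel_measurable (lebesgue_on (ball 0 1))"
    by (rule continuous_imp_measurable_on_sets_lebesgue) simp
  then show "(\<lambda>x. ereal (norm (gradient u x))) \<in> borel_measurable (lebesgue_on (ball 0 1))"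
    by measurable
  have "norm (gradient u x) \<le> 10 / R" if x: "x \<in> ball 0 1" for x
  proof -
    from x obtain \<xi> where \<xi>: "\<xi> \<in> open_cell \<rho>" "x = F \<xi>" using ball_subset by blast
    have "norm (fibre a c e \<xi>) \<le> 10"
      using closed_cell_bounds[OF open_cell_bounds(1)[OF \<xi>(1)]] \<rho> e a c by (intro fibre_bound) auto
    moreover have "norm (gradient u x) = 1 / R * norm (fibre a c e \<xi>)"
      using k R by (auto simp: \<xi>(2) gradient_u[OF \<xi>(1)])
    ultimately show ?thesis using R by (simp add: divide_right_mono)
  qed
  then show "AE x in lebesgue_on (ball 0 1). ereal (norm (gradient u x)) \<le> ereal (10 / R)"
    by (intro AE_I2) simp
qed

text \<open>At the origin the first column of \<open>jac_base\<close> is \<open>(e, 0, 0)\<close>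
  and the corner entry of \<open>jac_fibre\<close> is 1, so the corner entry of the Hessian is
  \<open>k / e\<close>.\<close>

lemma norm_hessian_u: "1 / e \<le> norm (hessian u 0)"
proof -
  have 0: "0 \<in> open_cell \<rho>" by (rule zero_in_open_cell[OF \<rho>(1)])
  have F0: "F 0 = 0" by (simp add: chart_map_def base_zero)
  have z: "tan1 0 = 0" "cossq1 0 = 1" by (simp_all add: tan1_def cossq1_def)
  have "(transpose (hessian u 0) ** jac_base a c e 0) $ 1 $ 1 = (k *\<^sub>R jac_fibre a c e 0) $ 1 $ 1"
    using hessian_u[OF 0] unfolding F0 by simp
  then have "hessian u 0 $ 1 $ 1 * e = k"
    by (simp add: matrix_matrix_mult_def transpose_def sum_3 jac_base_def jac_fibre_def vector_3 pot11_def pot12_def pot13_def z)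
  then have "\<bar>hessian u 0 $ 1 $ 1\<bar> * e = 1" using k e by (metis abs_1 abs_minus_cancel abs_mult abs_of_pos)
  then have "1 / e = \<bar>hessian u 0 $ 1 $ 1\<bar>" using e by (simp add: field_simps)
  also have "\<dots> \<le> norm (hessian u 0 $ 1)" by (rule component_le_norm_cart)
  also have "\<dots> \<le> norm (hessian u 0)" by (rule Finite_Cartesian_Product.norm_nth_le)
  finally show ?thesis .
qed

end

section \<open>Choice of the parameters and conclusion\<close>

text \<open>Take \<open>a = sin \<beta>\<close> and \<open>c = cos \<beta>\<close> with
  \<open>\<beta> = (pi / 2 + \<bar>\<Theta>\<bar>) / 2\<close>, which is \<open>- \<alpha>\<close>
  when \<open>\<Theta> \<le> 0\<close>. From \<open>pi / 4 \<le> \<beta> < pi / 2\<close> follows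
  \<open>0 < c \<le> a\<close>, and the phase is
  \<open>k * pi / 2 - 2 * k * \<beta> = \<Theta>\<close>.\<close>

lemma rotation_angle:
  fixes \<Theta> :: real
  assumes "\<bar>\<Theta>\<bar> < pi / 2"
  obtains a c k :: real where "0 < c" "c \<le> a" "a \<le> 1" "a\<^sup>2 + c\<^sup>2 = 1" "k = 1 \<or> k = - 1"
    "of_real k * \<i> * (of_real c - \<i> * of_real k * of_real a)\<^sup>2 = cis \<Theta>"
proof -
  define k :: real where "k = (if \<Theta> \<le> 0 then 1 else - 1)"
  define \<beta> where "\<beta> = (pi / 2 + \<bar>\<Theta>\<bar>) / 2"
  have k: "k = 1 \<or> k = - 1" by (simp add: k_def)
  have \<beta>: "pi / 4 \<le> \<beta>" "\<beta> < pi / 2" using assms by (simp_all add: \<beta>_def)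
  have "cos \<beta> > 0" using \<beta> pi_gt_zero by (intro cos_gt_zero) linarith+
  moreover have "cos \<beta> \<le> sin \<beta>"
  proof -
    have "sin (pi / 2 - \<beta>) \<le> sin \<beta>" using \<beta> pi_gt_zero by (intro sin_monotone_2pi_le) linarith+
    then show ?thesis by (simp add: sin_diff)
  qed
  moreover have "of_real k * \<i> * (of_real (cos \<beta>) - \<i> * of_real k * of_real (sin \<beta>))\<^sup>2 = cis \<Theta>"
  proof -
    have "of_real (cos \<beta>) - \<i> * of_real k * of_real (sin \<beta>) = cis (- k * \<beta>)"
      using k by (auto simp: complex_eq_iff)
    moreover have "of_real k * \<i> = cis (k * pi / 2)"
      using k by (auto simp: complex_eq_iff)
    ultimately have "of_real k * \<i> * (of_real (cos \<beta>) - \<i> * of_real k * of_real (sin \<beta>))\<^sup>2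
        = cis (k * pi / 2 + 2 * (- k * \<beta>))"
      by (simp add: power2_eq_square cis_mult mult.commute)
    also have "k * pi / 2 + 2 * (- k * \<beta>) = \<Theta>" by (simp add: k_def \<beta>_def)
    finally show ?thesis .
  qed
  ultimately show ?thesis using that[of "cos \<beta>" "sin \<beta>" k] k by simp
qed

theorem theorem1p2:
  fixes \<Theta> :: real
  assumes "\<Theta> \<in> {- (pi / 2) <..< pi / 2}"
  shows "\<exists>(\<epsilon>0::real) > 0. \<exists>(u :: real \<Rightarrow> real^3 \<Rightarrow> real) (C::real).
           (\<forall>\<epsilon>\<in>{0<..<\<epsilon>0}.
              smooth_on (ball 0 1) (u \<epsilon>) \<and>
              special_lagrangian \<Theta> (ball 0 1) (u \<epsilon>) \<and>
              Linfty_norm (ball 0 1) (gradient (u \<epsilon>)) \<le> ereal C) \<and>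
           filterlim (\<lambda>\<epsilon>. norm (hessian (u \<epsilon>) 0)) at_top (at_right 0)"
proof -
  have \<Theta>: "\<bar>\<Theta>\<bar> < pi / 2" using assms by auto
  obtain a c k :: real where ack: "0 < c" "c \<le> a" "a \<le> 1" "a\<^sup>2 + c\<^sup>2 = 1" "k = 1 \<or> k = - 1"
    "of_real k * \<i> * (of_real c - \<i> * of_real k * of_real a)\<^sup>2 = cis \<Theta>"
    using rotation_angle[OF \<Theta>] by blast
  \<comment> \<open>The largest value that \<open>small_cell\<close> admits; it depends on \<Theta>
    alone, and so can \<open>R\<close> and \<open>e0\<close> be fixed before \<epsilon>.\<close>
  define \<rho> where "\<rho> = min (c / 100) (1 / 1000)"
  interpret small_cell a c \<rho> using ack by unfold_locales (auto simp: \<rho>_def)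
  obtain R e0 where R: "R > 0" and e0: "e0 > 0" "e0 \<le> \<rho>"
    and ball: "\<And>e. 0 < e \<Longrightarrow> e \<le> e0 \<Longrightarrow> ball 0 R \<subseteq> base a c e ` open_cell \<rho>"
    using uniform_ball by blast
  have rot: "rotated_graph a c \<rho> k R e \<Theta>" if "e \<in> {0<..<e0}" for e
    using that ack R e0 ball[of e] \<Theta> by unfold_locales auto
  \<comment> \<open>The norm on \<open>real^3^3\<close> dominates each entry, so the comparison
    function is \<open>inverse \<epsilon>\<close>.\<close>
  have "filterlim (\<lambda>\<epsilon>. norm (hessian (solution a c \<rho> k R \<epsilon>) 0)) at_top (at_right 0)"
  proof (rule filterlim_at_top_mono[OF filterlim_inverse_at_top_right])
    have "eventually (\<lambda>e. e \<in> {0<..<e0}) (at_right 0)" by (rule eventually_at_right_real[OF e0(1)])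
    then show "\<forall>\<^sub>F e in at_right 0. inverse e \<le> norm (hessian (solution a c \<rho> k R e) 0)"
      by eventually_elim (use rotated_graph.norm_hessian_u[OF rot] in \<open>simp add: inverse_eq_divide\<close>)
  qed
  moreover have "smooth_on (ball 0 1) (solution a c \<rho> k R e)" if "e \<in> {0<..<e0}" for e
    by (rule smooth_on_subset[OF rotated_graph.smooth_on_u[OF rot[OF that]] rotated_graph.ball_subset[OF rot[OF that]]])
  ultimately show ?thesis
    using e0(1) rotated_graph.special_lagrangian_u[OF rot] rotated_graph.Linfty_norm_u[OF rot]
    by (intro exI[of _ e0] conjI exI[of _ "solution a c \<rho> k R"] exI[of _ "10 / R"] ballI) auto
qed

end
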